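(* Let $n\ge 2$ and $N\ge n+3$. For each $U\in\mathcal U$, the $N$-tuple $(\eta_1(U),\eta_2(U),\dots,\eta_N(U))$ is a $\tau_N$-configuration in $\mathbb R^{2\times n}\times\mathbb R^{2\times n}$. Moreover, writing $\eta_i(U)=(\eta_i^1(U),\eta_i^2(U))\in\mathbb R^{2\times n}\times\mathbb R^{2\times n}$, each $\eta_i^1(U)$ is linear in $P$ with coefficients that are rational functions of $(X,\kappa_1,\dots,\kappa_N)$, and each $\eta_i^2(U)$ is linear in $(Y,Z)$ with coefficients that are rational functions of $(X,b,\kappa_1,\dots,\kappa_N)$.
   Context: **$\tau_N$-configurations.** For $p\in\mathbb R^m$, $a\in\mathbb R^n$ put $p\otimes a=pa^T$; for a matrix $B$, $B\otimes a$ is the third-order tensor with entries $B_{jk}a_l$. An ordered $N$-tuple $(\xi_1,\dots,\xi_N)$ in $\mathbb R^{m\times n}\times\mathbb R^{m\times n}$ ($N>1$) is a $\tau_N$-configuration if there exist $\rho\in\mathbb R^{m\times n}\times\mathbb R^{m\times n}$, $\kappa_i>1$ and $\gamma_i=(p_i\otimes a_i,\,s_iB_i)$ ($1\le i\le N$) with $\xi_i=\rho+\gamma_1+\cdots+\gamma_{i-1}+\kappa_i\gamma_i$ for all $i$, where $p_i\in\mathbb R^m$, $a_i\in\mathbb R^n$, $s_i\in\mathbb R$, $B_i\in\mathbb R^{m\times n}$ satisfy $B_ia_i=0$ and $(|p_i|+|B_i|)(|a_i|+|s_i|)\ne0$ for all $i$, and $\sum_i p_i\otimes a_i=0$, $\sum_i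 B_i\otimes a_i=0$, $\sum_i s_ip_i=0$, $\sum_i s_iB_i=0$. (Here $m=2$.) **Parametrization.** For $\mathbf x,\mathbf y,\mathbf z\in\mathbb R^{n-1}$ and $1\le r\le n$ let $\alpha_r(\mathbf x)=(x_1,\dots,x_{r-1},1,x_r,\dots,x_{n-1})^T\in\mathbb R^n$; let $b_r(\mathbf x,\mathbf y)=(y_1,\dots,y_{r-1},-(\mathbf x\cdot\mathbf y),y_r,\dots,y_{n-1})$ (a row vector); and let $\beta_r(\mathbf x,\mathbf y,\mathbf z)\in\mathbb R^{2\times n}$ be the matrix with rows $b_r(\mathbf x,\mathbf y)$ and $b_r(\mathbf x,\mathbf z)$. For $1\le i\le N$ let $r_i\in\{1,\dots,n\}$ with $r_i\equiv i \pmod n$. The $n\times n$ matrix $b_r(\mathbf x,\mathbf y)\otimes\alpha_r(\mathbf x)$ has $(j,k)$ entry $b_r(\mathbf x,\mathbf y)_j\,\alpha_r(\mathbf x)_k$ (it has trace $0$). For $X=(\mathbf x_1,\dots,\mathbf x_N)\in(\mathbb R^{n-1})^N$ let $\Delta=\det[\alpha_1(\mathbf x_1)\cdots\alpha_n(\mathbf x_n)]$, and let $T$ be the determinant of the linear map $\mathbb R^{n^2-1}\to\mathbb R^{n^2-1}$ sending $(\mathbf y_1,\dots,\mathbf y_{n+1})$ to the entries other than the $(1,1)$ entry of $\sum_{i=1}^{n+1}b_{r_i}(\mathbf x_i,\mathbf y_i)\otimes\alpha_{r_i}(\mathbf x_i)$. $\mathcal V$ is the set of $(P,X)$, $P=(p_{n+1},\dots,p_N)\in(\mathbb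 R^2)^{N-n}$, $X\in(\mathbb R^{n-1})^N$, such that $\Delta\neq0$, $T\ne0$, $p_j\neq0$ for $n+1\le j\le N$, and the vectors $p_1,\dots,p_n\in\mathbb R^2$ uniquely determined by $\sum_{i=1}^Np_i\otimes\alpha_{r_i}(\mathbf x_i)=0$ are all nonzero. $\mathcal U$ is the set of $U=(P,X,Y,Z,b,\kappa_1,\dots,\kappa_N)$ with $(P,X)\in\mathcal V$, $Y=(\mathbf y_{n+2},\dots,\mathbf y_N)$, $Z=(\mathbf z_{n+2},\dots,\mathbf z_N)$ with $\mathbf y_j,\mathbf z_j\in\mathbb R^{n-1}$, $b\in\mathbb R^{n-2}$, and $\kappa_i>1$. It is an open subset of $\mathbb R^D$, $D=3nN-2n^2-n$. For $U\in\mathcal U$: $p_1,\dots,p_n\in\mathbb R^2$ are the unique vectors satisfying $\sum_{i=1}^Np_i\otimes\alpha_{r_i}(\mathbf x_i)=0$, where $p_{n+1},\dots,p_N$ are the components of $P$; $\mathbf y_1,\dots,\mathbf y_{n+1}$ (resp. $\mathbf z_1,\dots,\mathbf z_{n+1}$) are the unique solutions of $\sum_{i=1}^Nb_{r_i}(\mathbf x_i,\mathbf y_i)\otimes\alpha_{r_i}(\mathbf x_i)=0$ (resp. the same with $\mathbf z_i$ in place of $\mathbf y_i$); $q(b)=(1,1,b_1,\dots,b_{n-2})^T\in\mathbb R^n$; and for $1\le i\le N$: $a_i(U)=\alpha_{r_i}(\mathbf x_i)$, $B_i(U)=\beta_{r_i}(\mathbf x_i,\mathbf y_i,\mathbf z_i)$,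 $s_i(U)=a_i(U)\cdot q(b)$, $\gamma_i(U)=(p_i\otimes a_i(U),\,s_i(U)B_i(U))\in\mathbb R^{2\times n}\times\mathbb R^{2\times n}$, and $\eta_i(U)=\gamma_1(U)+\cdots+\gamma_{i-1}(U)+\kappa_i\gamma_i(U)$. *)

theory Defs
  imports Jordan_Normal_Form.Determinant "HOL-Library.FuncSet"
begin

text \<open>
  Families such as \<open>(x_1, ..., x_N)\<close> are functions on \<^typ>\<open>nat\<close> indexed from 1, as are the
  parameter \<open>r\<close> and the position \<open>i\<close> in a tuple.  Entries of vectors and matrices are indexed
  from 0, following \<^theory>\<open>Jordan_Normal_Form.Matrix\<close>.
\<close>

section \<open>Tensor products, sums and norms\<close>

definition outer :: "real vec \<Rightarrow> real vec \<Rightarrow> real mat" where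
  "outer p a = mat (dim_vec p) (dim_vec a) (\<lambda>(j, k). p $ j * a $ k)"

definition tensor3 :: "real mat \<Rightarrow> real vec \<Rightarrow> nat \<Rightarrow> nat \<Rightarrow> nat \<Rightarrow> real" where
  "tensor3 B a j k l = B $$ (j, k) * a $ l"

definition vec_sum :: "nat \<Rightarrow> nat set \<Rightarrow> (nat \<Rightarrow> real vec) \<Rightarrow> real vec" where
  "vec_sum m I f = vec m (\<lambda>j. \<Sum>i\<in>I. f i $ j)"

definition matrix_sum :: "nat \<Rightarrow> nat \<Rightarrow> nat set \<Rightarrow> (nat \<Rightarrow> real mat) \<Rightarrow> real mat" where
  "matrix_sum m n I f = mat m n (\<lambda>(j, k). \<Sum>i\<in>I. f i $$ (j, k))"

definition vnorm :: "real vec \<Rightarrow> real" where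
  "vnorm v = sqrt (\<Sum>j<dim_vec v. (v $ j)\<^sup>2)"

definition mnorm :: "real mat \<Rightarrow> real" where
  "mnorm B = sqrt (\<Sum>j<dim_row B. \<Sum>k<dim_col B. (B $$ (j, k))\<^sup>2)"


section \<open>Configurations\<close>

text \<open>\<open>partial_comb m n \<gamma> \<kappa> i\<close> is \<open>\<gamma>_1 + ... + \<gamma>_(i-1) + \<kappa>_i \<gamma>_i\<close>.\<close>

definition partial_comb ::
  "nat \<Rightarrow> nat \<Rightarrow> (nat \<Rightarrow> real mat \<times> real mat) \<Rightarrow> (nat \<Rightarrow> real) \<Rightarrow> nat \<Rightarrow> real mat \<times> real mat" where
  "partial_comb m n \<gamma> \<kappa> i =
    (matrix_sum m n {1..<i} (\<lambda>h. fst (\<gamma> h)) + \<kappa> i \<cdot>\<^sub>m fst (\<gamma> i),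
     matrix_sum m n {1..<i} (\<lambda>h. snd (\<gamma> h)) + \<kappa> i \<cdot>\<^sub>m snd (\<gamma> i))"

definition tau_configuration ::
  "nat \<Rightarrow> nat \<Rightarrow> nat \<Rightarrow> (nat \<Rightarrow> real mat \<times> real mat) \<Rightarrow> bool" where
  "tau_configuration m n N \<xi> \<longleftrightarrow>
    N > 1 \<and>
    (\<exists>\<rho> \<kappa> \<gamma> p a s B.
      \<rho> \<in> carrier_mat m n \<times> carrier_mat m n \<and>
      (\<forall>i\<in>{1..N}.
        \<kappa> i > 1 \<and>
        p i \<in> carrier_vec m \<and> a i \<in> carrier_vec n \<and> B i \<in> carrier_mat m n \<and>
        \<gamma> i = (outer (p i) (a i), s i \<cdot>\<^sub>m B i) \<and>
        \<xi> i = (fst \<rho> + fst (partial_comb m n \<gamma> \<kappa> i), snd \<rho> + snd (partial_comb m n \<gamma> \<kappa> i)) \<and>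
        B i *\<^sub>v a i = 0\<^sub>v m \<and>
        (vnorm (p i) + mnorm (B i)) * (vnorm (a i) + \<bar>s i\<bar>) \<noteq> 0) \<and>
      matrix_sum m n {1..N} (\<lambda>i. outer (p i) (a i)) = 0\<^sub>m m n \<and>
      (\<forall>j<m. \<forall>k<n. \<forall>l<n. (\<Sum>i\<in>{1..N}. tensor3 (B i) (a i) j k l) = 0) \<and>
      vec_sum m {1..N} (\<lambda>i. s i \<cdot>\<^sub>v p i) = 0\<^sub>v m \<and>
      matrix_sum m n {1..N} (\<lambda>i. s i \<cdot>\<^sub>m B i) = 0\<^sub>m m n)"


section \<open>The parametrization\<close>

definition alpha :: "nat \<Rightarrow> nat \<Rightarrow> real vec \<Rightarrow> real vec" where
  "alpha n r x = vec n (\<lambda>k. if k < r - 1 then x $ k else if k = r - 1 then 1 else x $ (k - 1))"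

definition brow :: "nat \<Rightarrow> nat \<Rightarrow> real vec \<Rightarrow> real vec \<Rightarrow> real vec" where
  "brow n r x y =
    vec n (\<lambda>k. if k < r - 1 then y $ k else if k = r - 1 then - (x \<bullet> y) else y $ (k - 1))"

definition beta :: "nat \<Rightarrow> nat \<Rightarrow> real vec \<Rightarrow> real vec \<Rightarrow> real vec \<Rightarrow> real mat" where
  "beta n r x y z = mat_of_rows n [brow n r x y, brow n r x z]"

text \<open>The representative of \<open>i\<close> modulo \<open>n\<close> in \<open>{1..n}\<close>, for \<open>i \<ge> 1\<close>.\<close>

definition res :: "nat \<Rightarrow> nat \<Rightarrow> nat" where
  "res n i = (i - 1) mod n + 1"

definition Delta :: "nat \<Rightarrow> (nat \<Rightarrow> real vec) \<Rightarrow> real" where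
  "Delta n X = det (mat_of_cols n (map (\<lambda>i. alpha n i (X i)) [1..<n + 1]))"

text \<open>
  The linear map whose determinant is \<open>T\<close>.  Its argument is the concatenation of
  \<open>y_1, ..., y_(n+1)\<close>; its value lists the entries of an \<open>n\<close> by \<open>n\<close> matrix row by row, leaving
  out the top left one.  Another ordering of the coordinates could only change the sign of \<open>T\<close>.
\<close>

definition T_map :: "nat \<Rightarrow> (nat \<Rightarrow> real vec) \<Rightarrow> real vec \<Rightarrow> real vec" where
  "T_map n X w =
    (let y = (\<lambda>i. vec (n - 1) (\<lambda>l. w $ ((i - 1) * (n - 1) + l)));
         M = matrix_sum n n {1..n + 1}
               (\<lambda>i. outer (brow n (res n i) (X i) (y i)) (alpha n (res n i) (X i)))
     in vec (n\<^sup>2 - 1) (\<lambda>e. M $$ ((e + 1) div n, (e + 1) mod n)))"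

definition T_det :: "nat \<Rightarrow> (nat \<Rightarrow> real vec) \<Rightarrow> real" where
  "T_det n X =
    det (mat_of_cols (n\<^sup>2 - 1) (map (\<lambda>c. T_map n X (unit_vec (n\<^sup>2 - 1) c)) [0..<n\<^sup>2 - 1]))"

text \<open>
  \<open>full_p\<close> extends \<open>(p_(n+1), ..., p_N)\<close> to \<open>(p_1, ..., p_N)\<close>, and \<open>full_y\<close> extends
  \<open>(y_(n+2), ..., y_N)\<close> to \<open>(y_1, ..., y_N)\<close>.  The solution is unique when \<open>Delta n X \<noteq> 0\<close>
  (resp. \<open>T_det n X \<noteq> 0\<close>).
\<close>

definition full_p ::
  "nat \<Rightarrow> nat \<Rightarrow> (nat \<Rightarrow> real vec) \<Rightarrow> (nat \<Rightarrow> real vec) \<Rightarrow> nat \<Rightarrow> real vec" where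
  "full_p n N P X = (THE p.
    p \<in> {1..N} \<rightarrow>\<^sub>E carrier_vec 2 \<and>
    (\<forall>j\<in>{n + 1..N}. p j = P j) \<and>
    matrix_sum 2 n {1..N} (\<lambda>i. outer (p i) (alpha n (res n i) (X i))) = 0\<^sub>m 2 n)"

definition full_y ::
  "nat \<Rightarrow> nat \<Rightarrow> (nat \<Rightarrow> real vec) \<Rightarrow> (nat \<Rightarrow> real vec) \<Rightarrow> nat \<Rightarrow> real vec" where
  "full_y n N Y X = (THE y.
    y \<in> {1..N} \<rightarrow>\<^sub>E carrier_vec (n - 1) \<and>
    (\<forall>j\<in>{n + 2..N}. y j = Y j) \<and>
    matrix_sum n n {1..N}
      (\<lambda>i. outer (brow n (res n i) (X i) (y i)) (alpha n (res n i) (X i))) = 0\<^sub>m n n)"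

definition V_set :: "nat \<Rightarrow> nat \<Rightarrow> ((nat \<Rightarrow> real vec) \<times> (nat \<Rightarrow> real vec)) set" where
  "V_set n N = {(P, X).
    P \<in> {n + 1..N} \<rightarrow>\<^sub>E carrier_vec 2 \<and>
    X \<in> {1..N} \<rightarrow>\<^sub>E carrier_vec (n - 1) \<and>
    Delta n X \<noteq> 0 \<and> T_det n X \<noteq> 0 \<and>
    (\<forall>j\<in>{n + 1..N}. P j \<noteq> 0\<^sub>v 2) \<and>
    (\<forall>i\<in>{1..n}. full_p n N P X i \<noteq> 0\<^sub>v 2)}"

type_synonym parameter =
  "(nat \<Rightarrow> real vec) \<times> (nat \<Rightarrow> real vec) \<times> (nat \<Rightarrow> real vec) \<times> (nat \<Rightarrow> real vec) \<times>
   real vec \<times> (nat \<Rightarrow> real)"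

definition U_set :: "nat \<Rightarrow> nat \<Rightarrow> parameter set" where
  "U_set n N = {(P, X, Y, Z, b, \<kappa>).
    (P, X) \<in> V_set n N \<and>
    Y \<in> {n + 2..N} \<rightarrow>\<^sub>E carrier_vec (n - 1) \<and>
    Z \<in> {n + 2..N} \<rightarrow>\<^sub>E carrier_vec (n - 1) \<and>
    b \<in> carrier_vec (n - 2) \<and>
    \<kappa> \<in> {1..N} \<rightarrow>\<^sub>E {1<..}}"

definition qvec :: "nat \<Rightarrow> real vec \<Rightarrow> real vec" where
  "qvec n b = vec n (\<lambda>k. if k < 2 then 1 else b $ (k - 2))"

fun a_of :: "nat \<Rightarrow> parameter \<Rightarrow> nat \<Rightarrow> real vec" where
  "a_of n (P, X, Y, Z, b, \<kappa>) i = alpha n (res n i) (X i)"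

fun B_of :: "nat \<Rightarrow> nat \<Rightarrow> parameter \<Rightarrow> nat \<Rightarrow> real mat" where
  "B_of n N (P, X, Y, Z, b, \<kappa>) i = beta n (res n i) (X i) (full_y n N Y X i) (full_y n N Z X i)"

fun s_of :: "nat \<Rightarrow> parameter \<Rightarrow> nat \<Rightarrow> real" where
  "s_of n (P, X, Y, Z, b, \<kappa>) i = a_of n (P, X, Y, Z, b, \<kappa>) i \<bullet> qvec n b"

fun gamma :: "nat \<Rightarrow> nat \<Rightarrow> parameter \<Rightarrow> nat \<Rightarrow> real mat \<times> real mat" where
  "gamma n N (P, X, Y, Z, b, \<kappa>) i =
    (outer (full_p n N P X i) (a_of n (P, X, Y, Z, b, \<kappa>) i),
     s_of n (P, X, Y, Z, b, \<kappa>) i \<cdot>\<^sub>m B_of n N (P, X, Y, Z, b, \<kappa>) i)"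

fun eta :: "nat \<Rightarrow> nat \<Rightarrow> parameter \<Rightarrow> nat \<Rightarrow> real mat \<times> real mat" where
  "eta n N (P, X, Y, Z, b, \<kappa>) i = partial_comb 2 n (gamma n N (P, X, Y, Z, b, \<kappa>)) \<kappa> i"


section \<open>Rational functions\<close>

text \<open>
  Polynomials in a set \<open>G\<close> of coordinate functions (compare \<open>real_polynomial_function\<close> in
  HOL-Analysis, which requires the variables to range over a normed vector space).
\<close>

inductive polynomial_in :: "('a \<Rightarrow> real) set \<Rightarrow> ('a \<Rightarrow> real) \<Rightarrow> bool" for G where
  const: "polynomial_in G (\<lambda>_. c)"
| coord: "g \<in> G \<Longrightarrow> polynomial_in G g"
| add: "polynomial_in G f \<Longrightarrow> polynomial_in G g \<Longrightarrow> polynomial_in G (\<lambda>v. f v + g v)"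
| mult: "polynomial_in G f \<Longrightarrow> polynomial_in G g \<Longrightarrow> polynomial_in G (\<lambda>v. f v * g v)"

text \<open>A single quotient of polynomials that has no pole on \<open>S\<close> and represents \<open>f\<close> there.\<close>

definition rational_on :: "('a \<Rightarrow> real) set \<Rightarrow> 'a set \<Rightarrow> ('a \<Rightarrow> real) \<Rightarrow> bool" where
  "rational_on G S f \<longleftrightarrow>
    (\<exists>g h. polynomial_in G g \<and> polynomial_in G h \<and> (\<forall>v\<in>S. h v \<noteq> 0 \<and> f v = g v / h v))"

definition coords_X_kappa :: "nat \<Rightarrow> nat \<Rightarrow> ((nat \<Rightarrow> real vec) \<times> (nat \<Rightarrow> real) \<Rightarrow> real) set" where
  "coords_X_kappa n N =
    {\<lambda>(X, \<kappa>). X i $ k | i k. i \<in> {1..N} \<and> k < n - 1} \<union>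
    {\<lambda>(X, \<kappa>). \<kappa> i | i. i \<in> {1..N}}"

definition coords_X_b_kappa ::
  "nat \<Rightarrow> nat \<Rightarrow> ((nat \<Rightarrow> real vec) \<times> real vec \<times> (nat \<Rightarrow> real) \<Rightarrow> real) set" where
  "coords_X_b_kappa n N =
    {\<lambda>(X, b, \<kappa>). X i $ k | i k. i \<in> {1..N} \<and> k < n - 1} \<union>
    {\<lambda>(X, b, \<kappa>). b $ k | k. k < n - 2} \<union>
    {\<lambda>(X, b, \<kappa>). \<kappa> i | i. i \<in> {1..N}}"

fun proj_X_kappa :: "parameter \<Rightarrow> (nat \<Rightarrow> real vec) \<times> (nat \<Rightarrow> real)" where
  "proj_X_kappa (P, X, Y, Z, b, \<kappa>) = (X, \<kappa>)"

fun proj_X_b_kappa :: "parameter \<Rightarrow> (nat \<Rightarrow> real vec) \<times> real vec \<times> (nat \<Rightarrow> real)" where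
  "proj_X_b_kappa (P, X, Y, Z, b, \<kappa>) = (X, b, \<kappa>)"

end

theory Submission
  imports Defs
begin

text \<open>
  All conditions on a configuration except the vanishing of \<open>\<Sum>\<^sub>i s\<^sub>i p\<^sub>i\<close> and \<open>\<Sum>\<^sub>i s\<^sub>i B\<^sub>i\<close> are built
  into the parametrization, and since \<open>s\<^sub>i = a\<^sub>i \<bullet> q\<close> these two sums are contractions with \<open>q\<close> of
  \<open>\<Sum>\<^sub>i p\<^sub>i \<otimes> a\<^sub>i = 0\<close> and \<open>\<Sum>\<^sub>i B\<^sub>i \<otimes> a\<^sub>i = 0\<close>.  Solving the two linear systems by Cramer's rule makes
  the dependent \<open>p\<^sub>i\<close>, \<open>y\<^sub>i\<close>, \<open>z\<^sub>i\<close> linear in \<open>P\<close>, \<open>Y\<close>, \<open>Z\<close>, with coefficients whose denominators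
  are \<^const>\<open>Delta\<close> and \<^const>\<open>T_det\<close>.
\<close>

section \<open>Polynomial and rational functions\<close>

lemma polynomial_in_sum:
  assumes "\<And>i. i \<in> I \<Longrightarrow> polynomial_in G (f i)"
  shows "polynomial_in G (\<lambda>v. \<Sum>i\<in>I. f i v)"
  using assms
  by (induction I rule: infinite_finite_induct)
     (auto intro: polynomial_in.const polynomial_in.add)

lemma polynomial_in_prod:
  assumes "\<And>i. i \<in> I \<Longrightarrow> polynomial_in G (f i)"
  shows "polynomial_in G (\<lambda>v. \<Prod>i\<in>I. f i v)"
  using assms
  by (induction I rule: infinite_finite_induct)
     (auto intro: polynomial_in.const polynomial_in.mult)

lemma polynomial_in_uminus:
  assumes "polynomial_in G f"
  shows "polynomial_in G (\<lambda>v. - f v)"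
  using polynomial_in.mult[OF polynomial_in.const[of G "-1"] assms] by simp

text \<open>The condition \<open>c\<close> does not depend on \<open>v\<close>, so the function is
  one of the two branches throughout. Case distinctions on indices are of this kind.\<close>

lemma polynomial_in_if:
  assumes "c \<Longrightarrow> polynomial_in G f" "\<not> c \<Longrightarrow> polynomial_in G g"
  shows "polynomial_in G (\<lambda>v. if c then f v else g v)"
  using assms by (cases c) auto

text \<open>The Leibniz formula writes the determinant as a signed sum of products of entries over
  permutations that do not depend on \<open>v\<close>.\<close>

lemma polynomial_in_det:
  assumes "\<And>v. A v \<in> carrier_mat m m"
    and "\<And>i j. i < m \<Longrightarrow> j < m \<Longrightarrow> polynomial_in G (\<lambda>v. A v $$ (i, j))"
  shows "polynomial_in G (\<lambda>v. det (A v))"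
  unfolding det_def'[OF assms(1)]
  by (intro polynomial_in_sum polynomial_in.mult polynomial_in.const polynomial_in_prod assms(2))
     (auto simp: permutes_in_image)

text \<open>Up to sign, each entry of the adjugate is a minor, hence a determinant of size
  \<open>m - 1\<close> with polynomial entries.\<close>

lemma polynomial_in_adj_mat:
  assumes A: "\<And>v. A v \<in> carrier_mat m m"
    and poly: "\<And>i j. i < m \<Longrightarrow> j < m \<Longrightarrow> polynomial_in G (\<lambda>v. A v $$ (i, j))"
    and ij: "i < m" "j < m"
  shows "polynomial_in G (\<lambda>v. adj_mat (A v) $$ (i, j))"
proof -
  have dims: "dim_row (A v) = m" "dim_col (A v) = m" for v
    using A[of v] by auto
  have "polynomial_in G (\<lambda>v. mat_delete (A v) j i $$ (i', j'))"
    if "i' < m - 1" "j' < m - 1" for i' j'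
    unfolding mat_delete_def using that ij
    by (auto simp: dims intro!: poly)
  then have "polynomial_in G (\<lambda>v. det (mat_delete (A v) j i))"
    by (intro polynomial_in_det[of _ "m - 1"]) (auto simp: dims mat_delete_def)
  then show ?thesis
    using ij by (auto simp: adj_mat_def cofactor_def dims
        intro!: polynomial_in.mult polynomial_in.const)
qed

section \<open>Rational functions without poles on a set\<close>

lemma rational_on_polynomial:
  assumes "polynomial_in G f"
  shows "rational_on G S f"
  unfolding rational_on_def
  by (intro exI[of _ f] exI[of _ "\<lambda>_. 1"]) (auto intro: assms polynomial_in.const)

lemma rational_on_divide:
  assumes "polynomial_in G f" "polynomial_in G h" "\<And>v. v \<in> S \<Longrightarrow> h v \<noteq> 0"
  shows "rational_on G S (\<lambda>v. f v / h v)"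
  unfolding rational_on_def using assms by blast

text \<open>One quotient must serve on all of \<open>S\<close>; the common denominator
  \<open>b v * d v\<close> has no zero there since neither factor has one.\<close>

lemma rational_on_add:
  assumes "rational_on G S f" "rational_on G S g"
  shows "rational_on G S (\<lambda>v. f v + g v)"
proof -
  from assms obtain a b c d where
    "polynomial_in G a" "polynomial_in G b" "polynomial_in G c" "polynomial_in G d"
    and eq: "\<forall>v\<in>S. b v \<noteq> 0 \<and> f v = a v / b v" "\<forall>v\<in>S. d v \<noteq> 0 \<and> g v = c v / d v"
    unfolding rational_on_def by blast
  then have "polynomial_in G (\<lambda>v. a v * d v + c v * b v)" "polynomial_in G (\<lambda>v. b v * d v)"
    by (auto intro: polynomial_in.mult polynomial_in.add)
  moreover have "\<forall>v\<in>S. b v * d v \<noteq> 0 \<and> f v + g v = (a v * d v + c v * b v) / (b v * d v)"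
    using eq by (simp add: add_frac_eq)
  ultimately show ?thesis unfolding rational_on_def by blast
qed

lemma rational_on_mult:
  assumes "rational_on G S f" "rational_on G S g"
  shows "rational_on G S (\<lambda>v. f v * g v)"
proof -
  from assms obtain a b c d where
    "polynomial_in G a" "polynomial_in G b" "polynomial_in G c" "polynomial_in G d"
    and eq: "\<forall>v\<in>S. b v \<noteq> 0 \<and> f v = a v / b v" "\<forall>v\<in>S. d v \<noteq> 0 \<and> g v = c v / d v"
    unfolding rational_on_def by blast
  then have "polynomial_in G (\<lambda>v. a v * c v)" "polynomial_in G (\<lambda>v. b v * d v)"
    by (auto intro: polynomial_in.mult)
  moreover have "\<forall>v\<in>S. b v * d v \<noteq> 0 \<and> f v * g v = (a v * c v) / (b v * d v)"
    using eq by simp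
  ultimately show ?thesis unfolding rational_on_def by blast
qed

lemma rational_on_sum:
  assumes "\<And>i. i \<in> I \<Longrightarrow> rational_on G S (f i)"
  shows "rational_on G S (\<lambda>v. \<Sum>i\<in>I. f i v)"
  using assms
  by (induction I rule: infinite_finite_induct)
     (auto intro: rational_on_polynomial polynomial_in.const rational_on_add)


section \<open>The linear systems\<close>

text \<open>Both products of \<open>A\<close> with its adjugate equal \<open>det A\<close> times the
  identity: one yields the formula for a given solution, the other shows that the formula solves the
  system. As an equivalence the rule covers existence and uniqueness at once.\<close>

lemma linear_system_iff:
  fixes A :: "real mat"
  assumes A: "A \<in> carrier_mat m m" and det: "det A \<noteq> 0"
  shows "(\<forall>k<m. (\<Sum>i<m. A $$ (k, i) * v i) = w k) \<longleftrightarrow>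
    (\<forall>i<m. v i = (\<Sum>k<m. adj_mat A $$ (i, k) * w k) / det A)"
proof -
  \<comment> \<open>Arbitrary \<open>B\<close> and \<open>C\<close> let the cancellation apply to
    both orders of \<open>A\<close> and its adjugate, with \<open>d = det A\<close>.\<close>
  have cancel: "(\<Sum>j<m. B $$ (i, j) * (\<Sum>k<m. C $$ (j, k) * u k)) = d * u i"
    if "B * C = d \<cdot>\<^sub>m 1\<^sub>m m" "B \<in> carrier_mat m m" "C \<in> carrier_mat m m" "i < m"
    for B C :: "real mat" and d u i
  proof -
    have *: "(\<Sum>j<m. B $$ (i, j) * C $$ (j, k)) = (if i = k then d else 0)" if "k < m" for k
      using arg_cong[OF \<open>B * C = _\<close>, of "\<lambda>M. M $$ (i, k)"] that \<open>i < m\<close> \<open>B \<in> _\<close> \<open>C \<in> _\<close>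
      by (simp add: scalar_prod_def atLeast0LessThan)
    have "(\<Sum>j<m. B $$ (i, j) * (\<Sum>k<m. C $$ (j, k) * u k)) =
        (\<Sum>j<m. \<Sum>k<m. B $$ (i, j) * C $$ (j, k) * u k)"
      by (simp add: sum_distrib_left mult.assoc)
    also have "\<dots> = (\<Sum>k<m. \<Sum>j<m. B $$ (i, j) * C $$ (j, k) * u k)"
      by (rule sum.swap)
    also have "\<dots> = (\<Sum>k<m. (if i = k then d else 0) * u k)"
      by (intro sum.cong refl) (simp add: * flip: sum_distrib_right)
    also have "\<dots> = (\<Sum>k<m. if k = i then d * u k else 0)"
      by (intro sum.cong) auto
    finally show ?thesis using \<open>i < m\<close> by simp
  qed
  note adj = adj_mat[OF A]
  show ?thesis
  proof (intro iffI allI impI)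
    fix i assume L: "\<forall>k<m. (\<Sum>i<m. A $$ (k, i) * v i) = w k" and i: "i < m"
    have "(\<Sum>k<m. adj_mat A $$ (i, k) * w k) = det A * v i"
      using cancel[OF adj(3,1) A i, of v] L by simp
    then show "v i = (\<Sum>k<m. adj_mat A $$ (i, k) * w k) / det A"
      using det by simp
  next
    fix k assume R: "\<forall>i<m. v i = (\<Sum>k<m. adj_mat A $$ (i, k) * w k) / det A" and k: "k < m"
    show "(\<Sum>i<m. A $$ (k, i) * v i) = w k"
      using cancel[OF adj(2) A adj(1) k, of w] R det
      by (simp flip: sum_divide_distrib)
  qed
qed

section \<open>Residues, and orthogonality and linearity of the rows\<close>

lemma res_less: "1 \<le> i \<Longrightarrow> i \<le> n \<Longrightarrow> res n i = i"
  by (simp add: res_def)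

lemma res_bounds: "n > 0 \<Longrightarrow> 1 \<le> res n i \<and> res n i \<le> n"
  by (simp add: res_def Suc_le_eq)

lemma dim_alpha [simp]: "dim_vec (alpha n r x) = n"
  by (simp add: alpha_def)

lemma dim_brow [simp]: "dim_vec (brow n r x y) = n"
  by (simp add: brow_def)

text \<open>The entry \<open>- (x \<bullet> y)\<close> of the row meets the entry 1 of
  \<open>alpha\<close>, and the remaining entries pair up to \<open>x \<bullet> y\<close>. This is
  behind both \<open>B a = 0\<close> and the vanishing trace of the products of rows with
  \<open>alpha\<close>.\<close>

lemma brow_alpha_orthogonal:
  assumes "1 \<le> r" "r \<le> n" "y \<in> carrier_vec (n - 1)"
  shows "(\<Sum>k<n. brow n r x y $ k * alpha n r x $ k) = 0"
proof -
  \<comment> \<open>\<open>q\<close> is the 0-based position of the distinguished entry, and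
    \<open>m\<close> is the number of the remaining ones.\<close>
  from assms obtain q m where q: "r = Suc q" and m: "n = Suc m" and le: "q \<le> m"
    by (cases r; cases n) auto
  let ?f = "\<lambda>k. brow n r x y $ k * alpha n r x $ k"
  have "(\<Sum>k<n. ?f k) = (\<Sum>k=0..<q. ?f k) + (?f q + (\<Sum>k=Suc q..<Suc m. ?f k))"
    using le unfolding m
    using sum.atLeastLessThan_concat[of 0 q n ?f] sum.atLeast_Suc_lessThan[of q n ?f] le m
    by (simp add: atLeast0LessThan del: sum.op_ivl_Suc)
  \<comment> \<open>Past position \<open>q\<close> both vectors carry their arguments shifted by
    one, which the reindexing undoes.\<close>
  also have "(\<Sum>k=Suc q..<Suc m. ?f k) = (\<Sum>k=q..<m. ?f (Suc k))"
    by (rule sum.shift_bounds_Suc_ivl)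
  also have "\<dots> = (\<Sum>k=q..<m. x $ k * y $ k)"
    by (rule sum.cong) (auto simp: brow_def alpha_def q m)
  also have "(\<Sum>k=0..<q. ?f k) = (\<Sum>k=0..<q. x $ k * y $ k)"
    using le by (intro sum.cong) (auto simp: brow_def alpha_def q m)
  also have "?f q = - (\<Sum>k=0..<m. x $ k * y $ k)"
    using assms(3) le by (auto simp: brow_def alpha_def q m scalar_prod_def)
  finally show ?thesis
    using sum.atLeastLessThan_concat[of 0 q m "\<lambda>k. x $ k * y $ k"] le by simp
qed

lemma sum_unit_vec:
  assumes "c < m"
  shows "(\<Sum>t<m. w t * unit_vec m t $ c) = (w c :: real)"
proof -
  have "(\<Sum>t<m. w t * unit_vec m t $ c) = (\<Sum>t<m. if t = c then w t else 0)"
    using assms by (intro sum.cong) auto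
  then show ?thesis using assms by simp
qed

text \<open>Expansion of \<open>y\<close> in the standard basis. Only the distinguished entry needs
  an argument, since there \<open>y\<close> enters through a scalar product with \<open>x\<close>;
  elsewhere a component of \<open>y\<close> is copied.\<close>

lemma brow_linear:
  assumes "1 \<le> r" "r \<le> n" "k < n" "y \<in> carrier_vec (n - 1)"
  shows "brow n r x y $ k = (\<Sum>t<n - 1. y $ t * brow n r x (unit_vec (n - 1) t) $ k)"
proof (cases "k = r - 1")
  case True
  have "(\<Sum>t<n - 1. y $ t * (x \<bullet> unit_vec (n - 1) t)) =
      (\<Sum>t<n - 1. \<Sum>s<n - 1. y $ t * (x $ s * unit_vec (n - 1) t $ s))"
    by (simp add: scalar_prod_def atLeast0LessThan sum_distrib_left)
  also have "\<dots> = (\<Sum>s<n - 1. \<Sum>t<n - 1. y $ t * (x $ s * unit_vec (n - 1) t $ s))"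
    by (rule sum.swap)
  also have "\<dots> = (\<Sum>s<n - 1. x $ s * (\<Sum>t<n - 1. y $ t * unit_vec (n - 1) t $ s))"
    by (simp add: sum_distrib_left mult_ac)
  also have "\<dots> = (\<Sum>s<n - 1. x $ s * y $ s)"
    by (intro sum.cong refl) (simp add: sum_unit_vec del: index_unit_vec)
  also have "\<dots> = x \<bullet> y"
    using assms(4) by (simp add: scalar_prod_def atLeast0LessThan)
  finally show ?thesis
    using True assms by (simp add: brow_def sum_negf)
next
  case False
  then show ?thesis
    using assms by (auto simp: brow_def sum_unit_vec simp del: index_unit_vec)
qed

section \<open>The linear system for the dependent vectors \<open>p_i\<close>\<close>

definition alpha_mat :: "nat \<Rightarrow> (nat \<Rightarrow> real vec) \<Rightarrow> real mat" where
  "alpha_mat n X = mat_of_cols n (map (\<lambda>i. alpha n i (X i)) [1..<n + 1])"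

text \<open>Coefficient of \<open>p_l\<close> in \<open>p_i\<close>. For \<open>i \<le> n\<close> it
  is Cramer's rule with the term of index \<open>l\<close> moved to the right-hand side, hence the
  minus sign; for \<open>i > n\<close> a Kronecker delta records that \<open>p_i\<close> is given.
  The index \<open>i - 1\<close> passes from families counted from 1 to rows counted from 0.\<close>

definition p_coeff :: "nat \<Rightarrow> (nat \<Rightarrow> real vec) \<Rightarrow> nat \<Rightarrow> nat \<Rightarrow> real" where
  "p_coeff n X i l =
    (if i \<le> n
     then (\<Sum>k<n. adj_mat (alpha_mat n X) $$ (i - 1, k) * - alpha n (res n l) (X l) $ k) / Delta n X
     else if i = l then 1 else 0)"

lemma alpha_mat_carrier: "alpha_mat n X \<in> carrier_mat n n"
  by (simp add: alpha_mat_def mat_of_cols_def del: upt_Suc)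

lemma alpha_mat_index:
  "i < n \<Longrightarrow> k < n \<Longrightarrow> alpha_mat n X $$ (k, i) = alpha n (Suc i) (X (Suc i)) $ k"
  by (simp add: alpha_mat_def mat_of_cols_index del: upt_Suc)

lemma matrix_sum_outer_eq_0_iff:
  assumes "\<And>i. i \<in> I \<Longrightarrow> dim_vec (f i) = m" "\<And>i. i \<in> I \<Longrightarrow> dim_vec (g i) = n"
  shows "matrix_sum m n I (\<lambda>i. outer (f i) (g i)) = 0\<^sub>m m n \<longleftrightarrow>
    (\<forall>t<m. \<forall>k<n. (\<Sum>i\<in>I. f i $ t * g i $ k) = 0)"
proof -
  have "(\<Sum>i\<in>I. outer (f i) (g i) $$ (t, k)) = (\<Sum>i\<in>I. f i $ t * g i $ k)" if "t < m" "k < n" for t k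
    using assms that by (intro sum.cong) (auto simp: outer_def)
  then show ?thesis
    by (simp add: matrix_sum_def mat_eq_iff)
qed

text \<open>Outside \<open>I\<close> every extensional function takes the same default value, so
  only the components on \<open>I\<close> matter. This makes solutions unique as functions, as the
  descriptions \<open>full_p\<close> and \<open>full_y\<close> require.\<close>

lemma eq_restrict_vec_iff:
  assumes "y \<in> I \<rightarrow>\<^sub>E carrier_vec m"
  shows "y = (\<lambda>i\<in>I. vec m (g i)) \<longleftrightarrow> (\<forall>i\<in>I. \<forall>t<m. y i $ t = g i t)"
proof
  assume R: "\<forall>i\<in>I. \<forall>t<m. y i $ t = g i t"
  show "y = (\<lambda>i\<in>I. vec m (g i))"
  proof
    fix i show "y i = (\<lambda>i\<in>I. vec m (g i)) i"
    proof (cases "i \<in> I")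
      case True
      then have "y i \<in> carrier_vec m" using assms by blast
      then show ?thesis using True R by (intro eq_vecI) auto
    qed (simp add: PiE_arb[OF assms])
  qed
qed simp

lemma sum_split_at:
  fixes g :: "nat \<Rightarrow> real"
  assumes "n \<le> N"
  shows "(\<Sum>i\<in>{1..N}. g i) = (\<Sum>i\<in>{1..n}. g i) + (\<Sum>i\<in>{n + 1..N}. g i)"
proof -
  have "{1..N} = {1..n} \<union> {n + 1..N}" using assms by auto
  then show ?thesis by (simp add: sum.union_disjoint)
qed

text \<open>With the given \<open>p_j\<close> fixed, each of the two components satisfies a separate
  square system with matrix \<open>alpha_mat n X\<close>, which Cramer's rule solves.\<close>

lemma p_system_iff:
  assumes "n \<le> N" "Delta n X \<noteq> 0" "P \<in> {n + 1..N} \<rightarrow> carrier_vec 2"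
    and p: "p \<in> {1..N} \<rightarrow>\<^sub>E carrier_vec 2"
  shows "(\<forall>j\<in>{n + 1..N}. p j = P j) \<and>
      matrix_sum 2 n {1..N} (\<lambda>i. outer (p i) (alpha n (res n i) (X i))) = 0\<^sub>m 2 n \<longleftrightarrow>
    p = (\<lambda>i\<in>{1..N}. vec 2 (\<lambda>t. \<Sum>l\<in>{n + 1..N}. P l $ t * p_coeff n X i l))"
    (is "?tail \<and> ?sys \<longleftrightarrow> ?sol")
proof -
  let ?a = "\<lambda>i. alpha n (res n i) (X i)"
  let ?A = "alpha_mat n X"
  let ?f = "\<lambda>i t. \<Sum>l\<in>{n + 1..N}. P l $ t * p_coeff n X i l"
  \<comment> \<open>The right-hand side after moving the given terms; \<open>t\<close> selects the
    component of the \<open>p_i\<close> and \<open>k\<close> the equation.\<close>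
  define w where "w t k = - (\<Sum>l\<in>{n + 1..N}. P l $ t * ?a l $ k)" for t k
  have Pc: "dim_vec (P j) = 2" if "j \<in> {n + 1..N}" for j
    using funcset_mem[OF assms(3) that] by simp
  have pc: "dim_vec (p j) = 2" if "j \<in> {1..N}" for j
    using PiE_mem[OF p that] by simp
  have det: "det ?A \<noteq> 0"
    using assms(2) by (simp add: Delta_def alpha_mat_def)
  \<comment> \<open>Cramer's rule is linear in the right-hand side: summing the coefficients over
    \<open>l\<close> reproduces the solution for \<open>w t\<close>.\<close>
  have head: "?f (Suc i) t = (\<Sum>k<n. adj_mat ?A $$ (i, k) * w t k) / det ?A" if "i < n" for i t
  proof -
    have "P l $ t * p_coeff n X (Suc i) l =
        (\<Sum>k<n. adj_mat ?A $$ (i, k) * - (P l $ t * ?a l $ k)) / det ?A" for l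
    proof -
      have "p_coeff n X (Suc i) l = (\<Sum>k<n. adj_mat ?A $$ (i, k) * - ?a l $ k) / det ?A"
        using that by (simp add: p_coeff_def Delta_def alpha_mat_def del: upt_Suc)
      then show ?thesis
        by (simp only: times_divide_eq_right sum_distrib_left mult_minus_right mult.left_commute)
    qed
    then have "?f (Suc i) t =
        (\<Sum>l\<in>{n + 1..N}. \<Sum>k<n. adj_mat ?A $$ (i, k) * - (P l $ t * ?a l $ k)) / det ?A"
      by (simp only: sum_divide_distrib)
    also have "(\<Sum>l\<in>{n + 1..N}. \<Sum>k<n. adj_mat ?A $$ (i, k) * - (P l $ t * ?a l $ k)) =
        (\<Sum>k<n. \<Sum>l\<in>{n + 1..N}. adj_mat ?A $$ (i, k) * - (P l $ t * ?a l $ k))"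
      by (rule sum.swap)
    finally show ?thesis
      by (simp add: w_def sum_distrib_left sum_negf)
  qed
  have tail: "?f j t = P j $ t" if "j \<in> {n + 1..N}" for j t
  proof -
    have "?f j t = (\<Sum>l\<in>{n + 1..N}. if l = j then P l $ t else 0)"
      using that by (intro sum.cong) (auto simp: p_coeff_def)
    then show ?thesis using that by simp
  qed
  \<comment> \<open>Under the tail equations the terms with \<open>i > n\<close> sum to
    \<open>- w t k\<close>, so the matrix condition becomes one square system for each
    \<open>t\<close>.\<close>
  have sys: "?sys \<longleftrightarrow> (\<forall>i<n. \<forall>t<2. p (Suc i) $ t = ?f (Suc i) t)" if ?tail
  proof -
    have "(\<Sum>i\<in>{1..N}. p i $ t * ?a i $ k) = (\<Sum>i<n. ?A $$ (k, i) * p (Suc i) $ t) - w t k"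
      if "k < n" for t k
    proof -
      have "(\<Sum>i\<in>{n + 1..N}. p i $ t * ?a i $ k) = - w t k"
        using \<open>?tail\<close> by (simp add: w_def)
      moreover have "(\<Sum>i\<in>{1..n}. p i $ t * ?a i $ k) = (\<Sum>i<n. ?A $$ (k, i) * p (Suc i) $ t)"
        using that by (auto simp: sum.atLeast1_atMost_eq alpha_mat_index res_less mult.commute
            intro!: sum.cong)
      ultimately show ?thesis
        using sum_split_at[OF assms(1), of "\<lambda>i. p i $ t * ?a i $ k"] by simp
    qed
    then have "?sys \<longleftrightarrow> (\<forall>t<2. \<forall>k<n. (\<Sum>i<n. ?A $$ (k, i) * p (Suc i) $ t) = w t k)"
      by (subst matrix_sum_outer_eq_0_iff) (auto simp: pc)
    also have "\<dots> \<longleftrightarrow> (\<forall>t<2. \<forall>i<n. p (Suc i) $ t = ?f (Suc i) t)"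
      unfolding linear_system_iff[OF alpha_mat_carrier det] by (simp only: head cong: conj_cong imp_cong)
    finally show ?thesis by blast
  qed
  have tail_iff: "?tail \<longleftrightarrow> (\<forall>j\<in>{n + 1..N}. \<forall>t<2. p j $ t = ?f j t)"
  proof (intro ball_cong refl)
    fix j assume "j \<in> {n + 1..N}"
    then show "p j = P j \<longleftrightarrow> (\<forall>t<2. p j $ t = ?f j t)"
      using Pc[of j] pc[of j] by (simp only: tail) (auto simp: vec_eq_iff)
  qed
  have all_iff: "(\<forall>i\<in>{1..N}. Q i) \<longleftrightarrow> (\<forall>j\<in>{n + 1..N}. Q j) \<and> (\<forall>i<n. Q (Suc i))" for Q
  proof -
    have "{1..N} = {n + 1..N} \<union> Suc ` {..<n}"
      using assms(1) by (auto simp: image_Suc_lessThan)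
    then show ?thesis by blast
  qed
  \<comment> \<open>The system is rewritten only under the tail equations, which the conjunction
    congruence makes available.\<close>
  show ?thesis
    unfolding eq_restrict_vec_iff[OF p] all_iff[of "\<lambda>i. \<forall>t<2. p i $ t = ?f i t"]
      tail_iff[symmetric]
    by (rule conj_cong[OF refl sys])
qed

text \<open>The equivalence applied to the displayed function yields existence, and applied to any
  other candidate it yields uniqueness.\<close>

lemma full_p_eq:
  assumes "n \<le> N" "Delta n X \<noteq> 0" "P \<in> {n + 1..N} \<rightarrow> carrier_vec 2"
  shows "full_p n N P X = (\<lambda>i\<in>{1..N}. vec 2 (\<lambda>t. \<Sum>l\<in>{n + 1..N}. P l $ t * p_coeff n X i l))"
    (is "_ = ?p")
proof -
  have p: "?p \<in> {1..N} \<rightarrow>\<^sub>E carrier_vec 2" by auto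
  show ?thesis
    unfolding full_p_def
  proof (rule the_equality)
    show "?p \<in> {1..N} \<rightarrow>\<^sub>E carrier_vec 2 \<and> (\<forall>j\<in>{n + 1..N}. ?p j = P j) \<and>
        matrix_sum 2 n {1..N} (\<lambda>i. outer (?p i) (alpha n (res n i) (X i))) = 0\<^sub>m 2 n"
      using p p_system_iff[OF assms p] by blast
  qed (use p_system_iff[OF assms] in blast)
qed

lemma full_p_system:
  assumes "n \<le> N" "Delta n X \<noteq> 0" "P \<in> {n + 1..N} \<rightarrow> carrier_vec 2"
  shows "full_p n N P X \<in> {1..N} \<rightarrow>\<^sub>E carrier_vec 2"
    and "\<forall>j\<in>{n + 1..N}. full_p n N P X j = P j"
    and "matrix_sum 2 n {1..N} (\<lambda>i. outer (full_p n N P X i) (alpha n (res n i) (X i))) = 0\<^sub>m 2 n"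
proof -
  show p: "full_p n N P X \<in> {1..N} \<rightarrow>\<^sub>E carrier_vec 2"
    unfolding full_p_eq[OF assms] by auto
  show "\<forall>j\<in>{n + 1..N}. full_p n N P X j = P j"
    and "matrix_sum 2 n {1..N} (\<lambda>i. outer (full_p n N P X i) (alpha n (res n i) (X i))) = 0\<^sub>m 2 n"
    using p_system_iff[OF assms p] full_p_eq[OF assms] by blast+
qed

section \<open>The linear system for the dependent vectors \<open>y_i\<close> and
  \<open>z_i\<close>\<close>

definition T_mat :: "nat \<Rightarrow> (nat \<Rightarrow> real vec) \<Rightarrow> real mat" where
  "T_mat n X =
    mat_of_cols (n\<^sup>2 - 1) (map (\<lambda>c. T_map n X (unit_vec (n\<^sup>2 - 1) c)) [0..<n\<^sup>2 - 1])"

text \<open>Contribution of the index \<open>i\<close> to equation number \<open>e\<close>. The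
  shift \<open>e + 1\<close> skips the top left entry in the row by row listing.\<close>

definition T_entry :: "nat \<Rightarrow> (nat \<Rightarrow> real vec) \<Rightarrow> nat \<Rightarrow> real vec \<Rightarrow> nat \<Rightarrow> real" where
  "T_entry n X i y e =
    brow n (res n i) (X i) y $ ((e + 1) div n) * alpha n (res n i) (X i) $ ((e + 1) mod n)"

text \<open>Coefficient of component \<open>s\<close> of \<open>y_l\<close> in component
  \<open>t\<close> of \<open>y_i\<close>: Cramer's rule for dependent indices, a Kronecker delta for
  given ones. The place of that component in the stacked unknown is
  \<open>(i - 1) * (n - 1) + t\<close>.\<close>

definition y_coeff :: "nat \<Rightarrow> (nat \<Rightarrow> real vec) \<Rightarrow> nat \<Rightarrow> nat \<Rightarrow> nat \<Rightarrow> nat \<Rightarrow> real" where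
  "y_coeff n X i t l s =
    (if i \<le> n + 1
     then (\<Sum>e<n\<^sup>2 - 1. adj_mat (T_mat n X) $$ ((i - 1) * (n - 1) + t, e) *
            - T_entry n X l (unit_vec (n - 1) s) e) / T_det n X
     else if i = l \<and> t = s then 1 else 0)"

text \<open>The system is square: \<open>n + 1\<close> blocks of \<open>n - 1\<close> unknowns face
  all entries but one of an \<open>n\<close> by \<open>n\<close> matrix.\<close>

lemma square_minus_1: "(n + 1) * (n - 1) = n\<^sup>2 - (1 :: nat)"
  by (cases n) (auto simp: power2_eq_square)

lemma T_index_bound:
  fixes n e :: nat
  assumes "n \<ge> 2" "e < n\<^sup>2 - 1"
  shows "(e + 1) div n < n" "(e + 1) mod n < n"
proof -
  have "e + 1 < n * n" using assms by (simp add: power2_eq_square)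
  then show "(e + 1) div n < n" by (rule less_mult_imp_div_less)
qed (use assms in simp)

lemma T_mat_carrier: "T_mat n X \<in> carrier_mat (n\<^sup>2 - 1) (n\<^sup>2 - 1)"
  by (simp add: T_mat_def mat_of_cols_def)

lemma T_map_index:
  assumes "n \<ge> 2" "e < n\<^sup>2 - 1"
  shows "T_map n X w $ e =
    (\<Sum>i\<in>{1..n + 1}. T_entry n X i (vec (n - 1) (\<lambda>l. w $ ((i - 1) * (n - 1) + l))) e)"
  using assms T_index_bound[OF assms]
  by (simp add: T_map_def Let_def matrix_sum_def T_entry_def outer_def)

lemma T_entry_linear:
  assumes "n \<ge> 2" "e < n\<^sup>2 - 1" "y \<in> carrier_vec (n - 1)"
  shows "T_entry n X i y e = (\<Sum>t<n - 1. y $ t * T_entry n X i (unit_vec (n - 1) t) e)"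
proof -
  have "1 \<le> res n i" "res n i \<le> n" using res_bounds[of n i] assms by auto
  then show ?thesis
    unfolding T_entry_def
    by (subst brow_linear) (use assms T_index_bound[OF assms(1,2)] in \<open>auto simp: sum_distrib_right mult.assoc\<close>)
qed

lemma stack_index_bound:
  assumes "i \<in> {1..n + 1}" "t < n - 1"
  shows "(i - 1) * (n - 1) + t < n\<^sup>2 - (1 :: nat)"
proof -
  have "(i - 1) * (n - 1) \<le> n * (n - 1)" using assms by (intro mult_right_mono) auto
  then show ?thesis
    using assms unfolding square_minus_1[symmetric] by (simp only: add_mult_distrib)
qed

lemma T_mat_index:
  assumes "n \<ge> 2" "e < n\<^sup>2 - 1" "c < n\<^sup>2 - 1"
  shows "T_mat n X $$ (e, c) = (\<Sum>i\<in>{1..n + 1}.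
    T_entry n X i (vec (n - 1) (\<lambda>l. unit_vec (n\<^sup>2 - 1) c $ ((i - 1) * (n - 1) + l))) e)"
  using assms by (simp add: T_mat_def mat_of_cols_index T_map_index del: index_unit_vec)

text \<open>The columns of \<open>T_mat\<close> are images of unit vectors, so by linearity its
  product with \<open>u\<close> is the value of the map at \<open>u\<close>. Each block is expanded
  in the standard basis before the sums are exchanged.\<close>

lemma T_mat_mult:
  assumes "n \<ge> 2" "e < n\<^sup>2 - 1"
  shows "(\<Sum>c<n\<^sup>2 - 1. T_mat n X $$ (e, c) * u c) =
    (\<Sum>i\<in>{1..n + 1}. T_entry n X i (vec (n - 1) (\<lambda>l. u ((i - 1) * (n - 1) + l))) e)"
proof -
  let ?E = "\<lambda>i t. T_entry n X i (unit_vec (n - 1) t) e"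
  let ?m = "n\<^sup>2 - 1"
  have "T_mat n X $$ (e, c) = (\<Sum>i\<in>{1..n + 1}. \<Sum>t<n - 1. unit_vec ?m c $ ((i - 1) * (n - 1) + t) * ?E i t)"
    if "c < ?m" for c
    using assms that
    by (simp add: T_mat_index T_entry_linear[of n e "vec _ _"] del: index_unit_vec)
  then have "(\<Sum>c<?m. T_mat n X $$ (e, c) * u c) =
      (\<Sum>c<?m. \<Sum>i\<in>{1..n + 1}. \<Sum>t<n - 1. u c * unit_vec ?m c $ ((i - 1) * (n - 1) + t) * ?E i t)"
    by (simp add: sum_distrib_left mult_ac del: index_unit_vec sum.cl_ivl_Suc)
  also have "\<dots> = (\<Sum>i\<in>{1..n + 1}. \<Sum>c<?m. \<Sum>t<n - 1. u c * unit_vec ?m c $ ((i - 1) * (n - 1) + t) * ?E i t)"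
    by (rule sum.swap)
  also have "\<dots> = (\<Sum>i\<in>{1..n + 1}. \<Sum>t<n - 1. \<Sum>c<?m. u c * unit_vec ?m c $ ((i - 1) * (n - 1) + t) * ?E i t)"
    by (intro sum.cong refl sum.swap)
  \<comment> \<open>The sum over \<open>c\<close> picks out the value of \<open>u\<close> at the
    stacked position, which lies in range.\<close>
  also have "\<dots> = (\<Sum>i\<in>{1..n + 1}. \<Sum>t<n - 1. u ((i - 1) * (n - 1) + t) * ?E i t)"
    by (intro sum.cong refl)
       (simp only: sum_unit_vec[OF stack_index_bound] lessThan_iff flip: sum_distrib_right)
  also have "\<dots> = (\<Sum>i\<in>{1..n + 1}. T_entry n X i (vec (n - 1) (\<lambda>l. u ((i - 1) * (n - 1) + l))) e)"
    using assms by (simp add: T_entry_linear[of n e "vec _ _"])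
  finally show ?thesis .
qed

text \<open>The entry that \<^const>\<open>T_map\<close> omits is recovered from the vanishing of the trace.\<close>

lemma brow_system_iff:
  assumes n: "n \<ge> 2" and y: "\<And>i. i \<in> I \<Longrightarrow> y i \<in> carrier_vec (n - 1)"
  shows "matrix_sum n n I (\<lambda>i. outer (brow n (res n i) (X i) (y i)) (alpha n (res n i) (X i))) = 0\<^sub>m n n \<longleftrightarrow>
    (\<forall>e<n\<^sup>2 - 1. (\<Sum>i\<in>I. T_entry n X i (y i) e) = 0)"
proof -
  let ?g = "\<lambda>j k. \<Sum>i\<in>I. brow n (res n i) (X i) (y i) $ j * alpha n (res n i) (X i) $ k"
  have "?g j k = 0" if E: "\<And>e. e < n\<^sup>2 - 1 \<Longrightarrow> (\<Sum>i\<in>I. T_entry n X i (y i) e) = 0"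
    and jk: "j < n" "k < n" for j k
  proof -
    \<comment> \<open>An entry other than the top left one is listed at position
      \<open>j * n + k - 1\<close>.\<close>
    have off: "?g j k = 0" if "j < n" "k < n" "j * n + k \<noteq> 0" for j k
    proof -
      have "j * n + k < Suc j * n" using that by simp
      also have "\<dots> \<le> n * n" using that by (intro mult_right_mono) auto
      finally have "j * n + k - 1 < n\<^sup>2 - 1"
        using that(3) unfolding power2_eq_square by linarith
      from E[OF this] show ?thesis using that by (simp add: T_entry_def)
    qed
    have "(\<Sum>k<n. ?g k k) = (\<Sum>i\<in>I. \<Sum>k<n. brow n (res n i) (X i) (y i) $ k * alpha n (res n i) (X i) $ k)"
      by (rule sum.swap)
    also have "\<dots> = 0"
      using n y res_bounds[of n] by (intro sum.neutral ballI brow_alpha_orthogonal) auto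
    finally have "?g 0 0 + (\<Sum>k\<in>{..<n} - {0}. ?g k k) = 0"
      using n sum.remove[of "{..<n}" 0 "\<lambda>k. ?g k k"] by simp
    moreover have "(\<Sum>k\<in>{..<n} - {0}. ?g k k) = 0"
      using n by (intro sum.neutral ballI off) auto
    ultimately show ?thesis using off[of j k] jk n by (cases "j = 0 \<and> k = 0") auto
  qed
  moreover have "(\<Sum>i\<in>I. T_entry n X i (y i) e) = 0"
    if "\<forall>j<n. \<forall>k<n. ?g j k = 0" "e < n\<^sup>2 - 1" for e
    unfolding T_entry_def using that T_index_bound[OF n that(2)] by blast
  moreover have "matrix_sum n n I (\<lambda>i. outer (brow n (res n i) (X i) (y i)) (alpha n (res n i) (X i))) = 0\<^sub>m n n \<longleftrightarrow>
      (\<forall>j<n. \<forall>k<n. ?g j k = 0)"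
    by (rule matrix_sum_outer_eq_0_iff) auto
  ultimately show ?thesis by blast
qed

text \<open>The scheme is that for the \<open>p_i\<close>, but components no longer decouple: the
  first \<open>n + 1\<close> vectors are stacked into one unknown for the matrix
  \<open>T_mat n X\<close>.\<close>

lemma y_system_iff:
  assumes n: "n \<ge> 2" "n + 1 \<le> N" and T: "T_det n X \<noteq> 0"
    and Y: "Y \<in> {n + 2..N} \<rightarrow> carrier_vec (n - 1)"
    and y: "y \<in> {1..N} \<rightarrow>\<^sub>E carrier_vec (n - 1)"
  shows "(\<forall>j\<in>{n + 2..N}. y j = Y j) \<and>
      matrix_sum n n {1..N}
        (\<lambda>i. outer (brow n (res n i) (X i) (y i)) (alpha n (res n i) (X i))) = 0\<^sub>m n n \<longleftrightarrow>
    y = (\<lambda>i\<in>{1..N}. vec (n - 1) (\<lambda>t. \<Sum>l\<in>{n + 2..N}. \<Sum>s<n - 1. Y l $ s * y_coeff n X i t l s))"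
    (is "?tail \<and> ?sys \<longleftrightarrow> ?sol")
proof -
  let ?m = "n\<^sup>2 - 1"
  let ?A = "T_mat n X"
  let ?f = "\<lambda>i t. \<Sum>l\<in>{n + 2..N}. \<Sum>s<n - 1. Y l $ s * y_coeff n X i t l s"
  define w where "w e = - (\<Sum>l\<in>{n + 2..N}. T_entry n X l (Y l) e)" for e
  \<comment> \<open>The stacked unknown; quotient and remainder by \<open>n - 1\<close>, positive
    since \<open>n \<ge> 2\<close>, recover block and component.\<close>
  define u where "u c = y (c div (n - 1) + 1) $ (c mod (n - 1))" for c
  have Yc: "Y j \<in> carrier_vec (n - 1)" if "j \<in> {n + 2..N}" for j
    using funcset_mem[OF Y that] .
  have yc: "y j \<in> carrier_vec (n - 1)" if "j \<in> {1..N}" for j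
    using PiE_mem[OF y that] .
  have det: "det ?A \<noteq> 0"
    using T by (simp add: T_det_def T_mat_def)
  have u: "u ((i - 1) * (n - 1) + t) = y i $ t" if "i \<in> {1..n + 1}" "t < n - 1" for i t
    using that by (simp add: u_def)
  have u_all: "(\<forall>c<?m. Q c) \<longleftrightarrow> (\<forall>i\<in>{1..n + 1}. \<forall>t<n - 1. Q ((i - 1) * (n - 1) + t))" for Q
  proof (intro iffI allI impI)
    fix c assume Q: "\<forall>i\<in>{1..n + 1}. \<forall>t<n - 1. Q ((i - 1) * (n - 1) + t)" and "c < ?m"
    then have "c div (n - 1) < n + 1"
      unfolding square_minus_1[symmetric] by (rule_tac less_mult_imp_div_less)
    moreover have "c mod (n - 1) < n - 1" using n by simp
    ultimately show "Q c"
      using bspec[OF Q, of "c div (n - 1) + 1"] div_mult_mod_eq[of c "n - 1"] by fastforce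
  qed (use stack_index_bound in blast)
  \<comment> \<open>The sum over \<open>s\<close> assembles \<open>T_entry\<close> at
    \<open>Y l\<close> from its values at unit vectors, so the coefficients reproduce Cramer's
    solution for \<open>w\<close>.\<close>
  have head: "?f i t = (\<Sum>e<?m. adj_mat ?A $$ ((i - 1) * (n - 1) + t, e) * w e) / det ?A"
    if "i \<in> {1..n + 1}" for i t
  proof -
    let ?B = "\<lambda>e. adj_mat ?A $$ ((i - 1) * (n - 1) + t, e)"
    let ?E = "\<lambda>l s e. T_entry n X l (unit_vec (n - 1) s) e"
    have "Y l $ s * y_coeff n X i t l s = (\<Sum>e<?m. ?B e * - (Y l $ s * ?E l s e)) / det ?A" for l s
    proof -
      have "y_coeff n X i t l s = (\<Sum>e<?m. ?B e * - ?E l s e) / det ?A"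
        using that by (simp add: y_coeff_def T_det_def T_mat_def)
      then show ?thesis
        by (simp only: times_divide_eq_right sum_distrib_left mult_minus_right mult.left_commute)
    qed
    then have "?f i t = (\<Sum>l\<in>{n + 2..N}. \<Sum>s<n - 1. \<Sum>e<?m. ?B e * - (Y l $ s * ?E l s e)) / det ?A"
      by (simp only: sum_divide_distrib)
    also have "(\<Sum>l\<in>{n + 2..N}. \<Sum>s<n - 1. \<Sum>e<?m. ?B e * - (Y l $ s * ?E l s e)) =
        (\<Sum>l\<in>{n + 2..N}. \<Sum>e<?m. \<Sum>s<n - 1. ?B e * - (Y l $ s * ?E l s e))"
      by (intro sum.cong refl sum.swap)
    also have "\<dots> = (\<Sum>e<?m. \<Sum>l\<in>{n + 2..N}. \<Sum>s<n - 1. ?B e * - (Y l $ s * ?E l s e))"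
      by (rule sum.swap)
    also have "\<dots> = (\<Sum>e<?m. ?B e * w e)"
      using n Yc by (intro sum.cong refl)
        (simp add: w_def T_entry_linear[of n _ "Y _"] sum_distrib_left sum_negf)
    finally show ?thesis .
  qed
  have tail: "?f j t = Y j $ t" if "j \<in> {n + 2..N}" "t < n - 1" for j t
  proof -
    have "(\<Sum>s<n - 1. Y l $ s * y_coeff n X j t l s) = (if l = j then Y j $ t else 0)" for l
    proof -
      have "(\<Sum>s<n - 1. Y l $ s * y_coeff n X j t l s) =
          (\<Sum>s<n - 1. if s = t then (if l = j then Y l $ s else 0) else 0)"
        using that by (intro sum.cong) (auto simp: y_coeff_def)
      then show ?thesis using that by simp
    qed
    then show ?thesis using that by simp
  qed
  \<comment> \<open>\<open>brow_system_iff\<close> reads the matrix condition as scalar equations;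
    under the tail equations the terms from index \<open>n + 2\<close> on sum to
    \<open>- w e\<close>.\<close>
  have sys: "?sys \<longleftrightarrow> (\<forall>i\<in>{1..n + 1}. \<forall>t<n - 1. y i $ t = ?f i t)" if ?tail
  proof -
    have "(\<Sum>i\<in>{1..N}. T_entry n X i (y i) e) = (\<Sum>c<?m. ?A $$ (e, c) * u c) - w e"
      if "e < ?m" for e
    proof -
      have "vec (n - 1) (\<lambda>t. u ((i - 1) * (n - 1) + t)) = y i" if "i \<in> {1..n + 1}" for i
        using u[OF that] yc[of i] that n by (auto simp: vec_eq_iff)
      then have "(\<Sum>c<?m. ?A $$ (e, c) * u c) = (\<Sum>i\<in>{1..n + 1}. T_entry n X i (y i) e)"
        by (simp only: T_mat_mult[OF n(1) that] cong: sum.cong)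
      moreover have "(\<Sum>i\<in>{n + 2..N}. T_entry n X i (y i) e) = - w e"
        using \<open>?tail\<close> by (simp add: w_def)
      ultimately show ?thesis
        using sum_split_at[OF n(2), of "\<lambda>i. T_entry n X i (y i) e"] by simp
    qed
    then have "?sys \<longleftrightarrow> (\<forall>e<?m. (\<Sum>c<?m. ?A $$ (e, c) * u c) = w e)"
      using yc n by (subst brow_system_iff) auto
    also have "\<dots> \<longleftrightarrow> (\<forall>c<?m. u c = (\<Sum>e<?m. adj_mat ?A $$ (c, e) * w e) / det ?A)"
      by (rule linear_system_iff[OF T_mat_carrier det])
    also have "\<dots> \<longleftrightarrow> (\<forall>i\<in>{1..n + 1}. \<forall>t<n - 1. y i $ t = ?f i t)"
      unfolding u_all using u head by simp
    finally show ?thesis .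
  qed
  have tail_iff: "?tail \<longleftrightarrow> (\<forall>j\<in>{n + 2..N}. \<forall>t<n - 1. y j $ t = ?f j t)"
  proof (intro ball_cong refl)
    fix j assume "j \<in> {n + 2..N}"
    then show "y j = Y j \<longleftrightarrow> (\<forall>t<n - 1. y j $ t = ?f j t)"
      using Yc[of j] yc[of j] by (simp only: tail cong: imp_cong) (auto simp: vec_eq_iff)
  qed
  have all_iff: "(\<forall>i\<in>{1..N}. Q i) \<longleftrightarrow> (\<forall>j\<in>{n + 2..N}. Q j) \<and> (\<forall>i\<in>{1..n + 1}. Q i)" for Q
  proof -
    have "{1..N} = {n + 2..N} \<union> {1..n + 1}" using n by auto
    then show ?thesis by blast
  qed
  show ?thesis
    unfolding eq_restrict_vec_iff[OF y] all_iff[of "\<lambda>i. \<forall>t<n - 1. y i $ t = ?f i t"]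
      tail_iff[symmetric]
    by (rule conj_cong[OF refl sys])
qed

lemma full_y_eq:
  assumes "n \<ge> 2" "n + 1 \<le> N" "T_det n X \<noteq> 0" "Y \<in> {n + 2..N} \<rightarrow> carrier_vec (n - 1)"
  shows "full_y n N Y X =
    (\<lambda>i\<in>{1..N}. vec (n - 1) (\<lambda>t. \<Sum>l\<in>{n + 2..N}. \<Sum>s<n - 1. Y l $ s * y_coeff n X i t l s))"
    (is "_ = ?y")
proof -
  have y: "?y \<in> {1..N} \<rightarrow>\<^sub>E carrier_vec (n - 1)" by auto
  show ?thesis
    unfolding full_y_def
  proof (rule the_equality)
    show "?y \<in> {1..N} \<rightarrow>\<^sub>E carrier_vec (n - 1) \<and> (\<forall>j\<in>{n + 2..N}. ?y j = Y j) \<and>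
        matrix_sum n n {1..N}
          (\<lambda>i. outer (brow n (res n i) (X i) (?y i)) (alpha n (res n i) (X i))) = 0\<^sub>m n n"
      using y y_system_iff[OF assms y] by blast
  qed (use y_system_iff[OF assms] in blast)
qed

lemma full_y_system:
  assumes "n \<ge> 2" "n + 1 \<le> N" "T_det n X \<noteq> 0" "Y \<in> {n + 2..N} \<rightarrow> carrier_vec (n - 1)"
  shows "full_y n N Y X \<in> {1..N} \<rightarrow>\<^sub>E carrier_vec (n - 1)"
    and "matrix_sum n n {1..N} (\<lambda>i. outer (brow n (res n i) (X i) (full_y n N Y X i))
      (alpha n (res n i) (X i))) = 0\<^sub>m n n"
proof -
  show y: "full_y n N Y X \<in> {1..N} \<rightarrow>\<^sub>E carrier_vec (n - 1)"
    unfolding full_y_eq[OF assms] by auto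
  show "matrix_sum n n {1..N} (\<lambda>i. outer (brow n (res n i) (X i) (full_y n N Y X i))
      (alpha n (res n i) (X i))) = 0\<^sub>m n n"
    using y_system_iff[OF assms y] full_y_eq[OF assms] by blast
qed


section \<open>The configuration\<close>

lemma beta_index:
  "j < 2 \<Longrightarrow> k < n \<Longrightarrow> beta n r x y z $$ (j, k) = brow n r x (if j = 0 then y else z) $ k"
  by (auto simp: beta_def mat_of_rows_index less_2_cases_iff)

lemma beta_carrier: "beta n r x y z \<in> carrier_mat 2 n"
  unfolding beta_def by (auto simp: mat_of_rows_def)

lemma beta_mult_alpha:
  assumes "1 \<le> r" "r \<le> n" "y \<in> carrier_vec (n - 1)" "z \<in> carrier_vec (n - 1)"
  shows "beta n r x y z *\<^sub>v alpha n r x = 0\<^sub>v 2"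
proof (rule eq_vecI)
  fix j assume "j < dim_vec (0\<^sub>v 2 :: real vec)"
  then have j: "j < 2" by simp
  have "(beta n r x y z *\<^sub>v alpha n r x) $ j = (\<Sum>k<n. beta n r x y z $$ (j, k) * alpha n r x $ k)"
    using j beta_carrier[of n r x y z] by (simp add: scalar_prod_def atLeast0LessThan)
  also have "\<dots> = (\<Sum>k<n. brow n r x (if j = 0 then y else z) $ k * alpha n r x $ k)"
    using j by (intro sum.cong) (auto simp: beta_index)
  also have "\<dots> = 0"
    using assms by (intro brow_alpha_orthogonal) auto
  finally show "(beta n r x y z *\<^sub>v alpha n r x) $ j = 0\<^sub>v 2 $ j" using j by simp
qed (use beta_carrier[of n r x y z] in auto)

lemma vnorm_pos:
  assumes "k < dim_vec v" "v $ k \<noteq> 0"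
  shows "vnorm v > 0"
  unfolding vnorm_def using assms by (simp add: sum_pos2[of _ k])

lemma mnorm_nonneg: "mnorm B \<ge> 0"
  unfolding mnorm_def by (simp add: sum_nonneg)

text \<open>Exchanging the sums exhibits the left-hand side as the contraction of \<open>q\<close>
  with the sum of the \<open>c i\<close> times \<open>a i\<close>. With \<open>c\<close> a component
  of \<open>p\<close> or an entry of \<open>B\<close>, this settles the conditions on
  \<open>s_i p_i\<close> and \<open>s_i B_i\<close>.\<close>

lemma sum_scalar_prod_eq_0:
  assumes "\<And>k. k < dim_vec q \<Longrightarrow> (\<Sum>i\<in>I. c i * a i $ k) = (0 :: real)"
  shows "(\<Sum>i\<in>I. (a i \<bullet> q) * c i) = 0"
proof -
  have "(\<Sum>i\<in>I. (a i \<bullet> q) * c i) = (\<Sum>i\<in>I. \<Sum>k<dim_vec q. q $ k * (c i * a i $ k))"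
    by (simp add: scalar_prod_def atLeast0LessThan sum_distrib_left mult_ac)
  also have "\<dots> = (\<Sum>k<dim_vec q. \<Sum>i\<in>I. q $ k * (c i * a i $ k))"
    by (rule sum.swap)
  also have "\<dots> = 0"
    using assms by (simp flip: sum_distrib_left)
  finally show ?thesis .
qed

lemma partial_comb_carrier:
  assumes "fst (\<gamma> i) \<in> carrier_mat m n" "snd (\<gamma> i) \<in> carrier_mat m n"
  shows "fst (partial_comb m n \<gamma> \<kappa> i) \<in> carrier_mat m n"
    and "snd (partial_comb m n \<gamma> \<kappa> i) \<in> carrier_mat m n"
  using assms by (auto simp: partial_comb_def matrix_sum_def)

lemma outer_carrier: "p \<in> carrier_vec m \<Longrightarrow> a \<in> carrier_vec n \<Longrightarrow> outer p a \<in> carrier_mat m n"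
  by (auto simp: outer_def)

lemma U_setD:
  assumes "(P, X, Y, Z, b, \<kappa>) \<in> U_set n N"
  shows "P \<in> {n + 1..N} \<rightarrow> carrier_vec 2" "Delta n X \<noteq> 0" "T_det n X \<noteq> 0"
    "Y \<in> {n + 2..N} \<rightarrow> carrier_vec (n - 1)" "Z \<in> {n + 2..N} \<rightarrow> carrier_vec (n - 1)"
    "\<forall>i\<in>{n + 1..N}. P i \<noteq> 0\<^sub>v 2" "\<forall>i\<in>{1..n}. full_p n N P X i \<noteq> 0\<^sub>v 2"
    "\<And>i. i \<in> {1..N} \<Longrightarrow> \<kappa> i > 1"
  using assms unfolding U_set_def V_set_def PiE_def by (auto simp: Pi_iff)

text \<open>The parametrization supplies its own witnesses: \<open>\<rho>\<close> is zero,
  \<open>s_i\<close> is \<open>a i \<bullet> q\<close>, and the remaining data are those of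
  \<open>U\<close>.\<close>

lemma tau_configuration_eta:
  assumes n: "n \<ge> 2" "n + 1 \<le> N" and U: "U \<in> U_set n N"
  shows "tau_configuration 2 n N (eta n N U)"
proof -
  obtain P X Y Z b \<kappa> where U_eq: "U = (P, X, Y, Z, b, \<kappa>)"
    by (cases U) auto
  note D = U_setD[OF U[unfolded U_eq]]
  define p where "p = full_p n N P X"
  define y where "y = full_y n N Y X"
  define z where "z = full_y n N Z X"
  define a where "a i = alpha n (res n i) (X i)" for i
  define B where "B i = beta n (res n i) (X i) (y i) (z i)" for i
  define q where "q = qvec n b"
  define \<gamma> where "\<gamma> = gamma n N U"
  have "n \<le> N" using n by simp
  note p = full_p_system[OF \<open>n \<le> N\<close> D(2,1), folded p_def]
  note y = full_y_system[OF n D(3,4), folded y_def]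
  note z = full_y_system[OF n D(3,5), folded z_def]
  have r: "1 \<le> res n i" "res n i \<le> n" for i
    using res_bounds[of n i] n by auto
  have dim_q: "dim_vec q = n" by (simp add: q_def qvec_def)
  have \<gamma>: "\<gamma> i = (outer (p i) (a i), (a i \<bullet> q) \<cdot>\<^sub>m B i)" for i
    by (simp add: \<gamma>_def U_eq p_def a_def q_def B_def y_def z_def)
  have pc: "p i \<in> carrier_vec 2" and yc: "y i \<in> carrier_vec (n - 1)" and zc: "z i \<in> carrier_vec (n - 1)"
    if "i \<in> {1..N}" for i
    by (fact PiE_mem[OF p(1) that] PiE_mem[OF y(1) that] PiE_mem[OF z(1) that])+
  have ac: "a i \<in> carrier_vec n" for i
    unfolding a_def by (rule carrier_vecI) simp
  have Bc: "B i \<in> carrier_mat 2 n" for i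
    by (simp add: B_def beta_carrier)
  have sum_p: "(\<Sum>i\<in>{1..N}. p i $ t * a i $ k) = 0" if "t < 2" "k < n" for t k
    using p(3) pc that by (subst (asm) matrix_sum_outer_eq_0_iff) (auto simp: a_def)
  \<comment> \<open>Row 0 of \<open>B i\<close> comes from the system for \<open>y\<close>, row 1
    from that for \<open>z\<close>.\<close>
  have sum_B: "(\<Sum>i\<in>{1..N}. B i $$ (j, k) * a i $ l) = 0" if "j < 2" "k < n" "l < n" for j k l
  proof -
    have "(\<Sum>i\<in>{1..N}. brow n (res n i) (X i) (if j = 0 then y i else z i) $ k * a i $ l) = 0"
      using y(2) z(2) that unfolding a_def
      by (cases "j = 0") (simp_all add: matrix_sum_outer_eq_0_iff)
    then show ?thesis
      using that by (simp add: B_def beta_index)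
  qed
  \<comment> \<open>The zero summand \<open>\<rho>\<close> disappears because both components of the
    combination inherit size \<open>2\<close> by \<open>n\<close> from
    \<open>\<gamma> i\<close>.\<close>
  have xi: "eta n N U i = (0\<^sub>m 2 n + fst (partial_comb 2 n \<gamma> \<kappa> i), 0\<^sub>m 2 n + snd (partial_comb 2 n \<gamma> \<kappa> i))"
    if "i \<in> {1..N}" for i
  proof -
    have "fst (\<gamma> i) \<in> carrier_mat 2 n" "snd (\<gamma> i) \<in> carrier_mat 2 n"
      using outer_carrier[OF pc[OF that] ac] Bc by (auto simp: \<gamma>)
    then show ?thesis
      using partial_comb_carrier[of \<gamma> i 2 n \<kappa>] by (simp add: U_eq \<gamma>_def)
  qed
  \<comment> \<open>\<open>p i\<close> is nonzero by the conditions in \<open>V_set\<close>, imposed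
    on \<open>full_p\<close> for \<open>i \<le> n\<close> and on \<open>P\<close> for
    \<open>i > n\<close>; \<open>a i\<close> is nonzero because it has an entry 1.\<close>
  have nonzero: "(vnorm (p i) + mnorm (B i)) * (vnorm (a i) + \<bar>a i \<bullet> q\<bar>) \<noteq> 0" if i: "i \<in> {1..N}" for i
  proof -
    have "p i \<noteq> 0\<^sub>v 2"
      using D(6,7) p(2) i by (cases "i \<le> n") (auto simp: p_def)
    then obtain t where "t < 2" "p i $ t \<noteq> 0"
      using pc[OF i] by (auto simp: vec_eq_iff)
    then have "vnorm (p i) > 0"
      using pc[OF i] by (intro vnorm_pos[of t]) auto
    moreover have "vnorm (a i) > 0"
      using r[of i] by (intro vnorm_pos[of "res n i - 1"]) (auto simp: a_def alpha_def)
    ultimately show ?thesis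
      using mnorm_nonneg[of "B i"] by (simp add: add_pos_nonneg less_imp_neq[symmetric])
  qed
  have "vec_sum 2 {1..N} (\<lambda>i. (a i \<bullet> q) \<cdot>\<^sub>v p i) = 0\<^sub>v 2"
  proof (rule eq_vecI)
    fix t assume "t < dim_vec (0\<^sub>v 2 :: real vec)"
    then have t: "t < 2" by simp
    have "(\<Sum>i\<in>{1..N}. ((a i \<bullet> q) \<cdot>\<^sub>v p i) $ t) = (\<Sum>i\<in>{1..N}. (a i \<bullet> q) * p i $ t)"
      using t pc by (intro sum.cong refl) (metis carrier_vecD index_smult_vec(1))
    also have "\<dots> = 0"
      using sum_p[OF t] by (intro sum_scalar_prod_eq_0) (simp add: dim_q)
    finally show "vec_sum 2 {1..N} (\<lambda>i. (a i \<bullet> q) \<cdot>\<^sub>v p i) $ t = 0\<^sub>v 2 $ t"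
      using t by (simp add: vec_sum_def)
  qed (simp add: vec_sum_def)
  moreover have "matrix_sum 2 n {1..N} (\<lambda>i. (a i \<bullet> q) \<cdot>\<^sub>m B i) = 0\<^sub>m 2 n"
  proof (rule eq_matI)
    fix j k assume "j < dim_row (0\<^sub>m 2 n :: real mat)" "k < dim_col (0\<^sub>m 2 n :: real mat)"
    then have jk: "j < 2" "k < n" by auto
    have "(\<Sum>i\<in>{1..N}. ((a i \<bullet> q) \<cdot>\<^sub>m B i) $$ (j, k)) = (\<Sum>i\<in>{1..N}. (a i \<bullet> q) * B i $$ (j, k))"
      using jk Bc by (intro sum.cong refl) (metis carrier_matD index_smult_mat(1))
    also have "\<dots> = 0"
      using sum_B[OF jk] by (intro sum_scalar_prod_eq_0) (simp add: dim_q)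
    finally show "matrix_sum 2 n {1..N} (\<lambda>i. (a i \<bullet> q) \<cdot>\<^sub>m B i) $$ (j, k) = 0\<^sub>m 2 n $$ (j, k)"
      using jk by (simp add: matrix_sum_def)
  qed (simp_all add: matrix_sum_def)
  moreover have "matrix_sum 2 n {1..N} (\<lambda>i. outer (p i) (a i)) = 0\<^sub>m 2 n"
    using p(3) by (simp add: a_def)
  moreover have "B i *\<^sub>v a i = 0\<^sub>v 2" if "i \<in> {1..N}" for i
    unfolding B_def a_def by (rule beta_mult_alpha[OF r yc[OF that] zc[OF that]])
  moreover have "\<forall>j<2. \<forall>k<n. \<forall>l<n. (\<Sum>i\<in>{1..N}. tensor3 (B i) (a i) j k l) = 0"
    unfolding tensor3_def using sum_B by blast
  moreover have "N > 1" using n by simp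
  ultimately show ?thesis
    unfolding tau_configuration_def
    apply (intro conjI)
     apply assumption
    apply (rule exI[of _ "(0\<^sub>m 2 n, 0\<^sub>m 2 n)"], rule exI[of _ \<kappa>], rule exI[of _ \<gamma>], rule exI[of _ p],
        rule exI[of _ a], rule exI[of _ "\<lambda>i. a i \<bullet> q"], rule exI[of _ B])
    apply (intro conjI ballI)
    using D(8) pc ac Bc xi nonzero by (simp_all only: \<gamma> fst_conv snd_conv not_False_eq_True mem_Sigma_iff zero_carrier_mat)
qed


section \<open>The coefficients\<close>

text \<open>Coefficient of \<open>\<gamma>_h\<close> in \<open>\<eta>_i\<close>, extended by zero so
  that sums range over \<open>{1..N}\<close> whatever \<open>i\<close> is.\<close>

definition weight :: "(nat \<Rightarrow> real) \<Rightarrow> nat \<Rightarrow> nat \<Rightarrow> real" where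
  "weight \<kappa> i h = (if h < i then 1 else if h = i then \<kappa> i else 0)"

lemma sum_weight:
  assumes "i \<in> {1..N}"
  shows "(\<Sum>h\<in>{1..<i}. g h) + \<kappa> i * g i = (\<Sum>h\<in>{1..N}. weight \<kappa> i h * g h)"
proof -
  have split: "{1..N} = {1..<i} \<union> ({i} \<union> {i<..N})" using assms by auto
  have "(\<Sum>h\<in>{1..<i}. weight \<kappa> i h * g h) = (\<Sum>h\<in>{1..<i}. g h)"
    by (intro sum.cong) (auto simp: weight_def)
  moreover have "(\<Sum>h\<in>{i<..N}. weight \<kappa> i h * g h) = 0"
    by (intro sum.neutral) (auto simp: weight_def)
  ultimately show ?thesis
    unfolding split by (subst sum.union_disjoint; auto simp: weight_def)+
qed

text \<open>Coefficient of component \<open>j\<close> of \<open>p_l\<close> in entry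
  \<open>(j, k)\<close> of the first matrix of \<open>\<eta>_i\<close>; both rows share it, so
  \<open>j\<close> is no argument.\<close>

definition p_eta_coeff ::
  "nat \<Rightarrow> nat \<Rightarrow> (nat \<Rightarrow> real vec) \<Rightarrow> (nat \<Rightarrow> real) \<Rightarrow> nat \<Rightarrow> nat \<Rightarrow> nat \<Rightarrow> real" where
  "p_eta_coeff n N X \<kappa> i k l =
    (\<Sum>h\<in>{1..N}. weight \<kappa> i h * (p_coeff n X h l * alpha n (res n h) (X h) $ k))"

text \<open>In column \<open>k\<close> of the second matrix of \<open>\<eta>_i\<close>, the
  coefficient of component \<open>s\<close> of \<open>y_l\<close> in row 0 and of \<open>z_l\<close>
  in row 1.\<close>

definition y_eta_coeff ::
  "nat \<Rightarrow> nat \<Rightarrow> (nat \<Rightarrow> real vec) \<Rightarrow> real vec \<Rightarrow> (nat \<Rightarrow> real) \<Rightarrow> nat \<Rightarrow> nat \<Rightarrow> nat \<Rightarrow> nat \<Rightarrow> real" where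
  "y_eta_coeff n N X b \<kappa> i k l s =
    (\<Sum>h\<in>{1..N}. weight \<kappa> i h * ((alpha n (res n h) (X h) \<bullet> qvec n b) *
      (\<Sum>t<n - 1. y_coeff n X h t l s * brow n (res n h) (X h) (unit_vec (n - 1) t) $ k)))"

text \<open>Inserting the solved form of the \<open>p_h\<close> and exchanging the two sums isolates
  the coefficient of each free vector.\<close>

lemma eta_fst:
  assumes n: "n \<ge> 2" "n + 1 \<le> N" and U: "(P, X, Y, Z, b, \<kappa>) \<in> U_set n N"
    and i: "i \<in> {1..N}" and jk: "j < 2" "k < n"
  shows "fst (eta n N (P, X, Y, Z, b, \<kappa>) i) $$ (j, k) =
    (\<Sum>l\<in>{n + 1..N}. p_eta_coeff n N X \<kappa> i k l * P l $ j)"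
proof -
  note D = U_setD[OF U]
  let ?a = "\<lambda>h. alpha n (res n h) (X h)"
  let ?p = "full_p n N P X"
  have p: "?p h \<in> carrier_vec 2" if "h \<in> {1..N}" for h
    using full_p_system(1)[OF _ D(2,1)] n that by auto
  have outer: "outer (?p h) (?a h) $$ (j, k) = ?p h $ j * ?a h $ k" if "h \<in> {1..N}" for h
    using p[OF that] jk by (simp add: outer_def)
  have "fst (eta n N (P, X, Y, Z, b, \<kappa>) i) $$ (j, k) =
      (\<Sum>h\<in>{1..<i}. outer (?p h) (?a h) $$ (j, k)) + \<kappa> i * outer (?p i) (?a i) $$ (j, k)"
    using jk p[OF i] by (simp add: partial_comb_def matrix_sum_def outer_def)
  also have "\<dots> = (\<Sum>h\<in>{1..N}. weight \<kappa> i h * outer (?p h) (?a h) $$ (j, k))"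
    by (rule sum_weight[OF i])
  also have "\<dots> = (\<Sum>h\<in>{1..N}. weight \<kappa> i h * (?p h $ j * ?a h $ k))"
    by (simp only: outer cong: sum.cong)
  also have "\<dots> = (\<Sum>h\<in>{1..N}. \<Sum>l\<in>{n + 1..N}. weight \<kappa> i h * (p_coeff n X h l * ?a h $ k) * P l $ j)"
    using full_p_eq[OF _ D(2,1)] n jk
    by (intro sum.cong refl) (simp add: sum_distrib_left sum_distrib_right mult_ac)
  also have "\<dots> = (\<Sum>l\<in>{n + 1..N}. \<Sum>h\<in>{1..N}. weight \<kappa> i h * (p_coeff n X h l * ?a h $ k) * P l $ j)"
    by (rule sum.swap)
  finally show ?thesis
    by (simp only: p_eta_coeff_def sum_distrib_right)
qed

text \<open>Row 0 depends on \<open>Y\<close> and row 1 on \<open>Z\<close> by the same formula, so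
  one family \<open>W\<close> stands for whichever applies.\<close>

lemma eta_snd:
  assumes n: "n \<ge> 2" "n + 1 \<le> N" and U: "(P, X, Y, Z, b, \<kappa>) \<in> U_set n N"
    and i: "i \<in> {1..N}" and jk: "j < 2" "k < n"
  shows "snd (eta n N (P, X, Y, Z, b, \<kappa>) i) $$ (j, k) =
    (\<Sum>l\<in>{n + 2..N}. \<Sum>s<n - 1. y_eta_coeff n N X b \<kappa> i k l s * (if j = 0 then Y else Z) l $ s)"
proof -
  note D = U_setD[OF U]
  define W where "W = (if j = 0 then Y else Z)"
  have Wc: "W \<in> {n + 2..N} \<rightarrow> carrier_vec (n - 1)"
    using D(4,5) by (simp add: W_def)
  let ?w = "full_y n N W X"
  let ?s = "\<lambda>h. alpha n (res n h) (X h) \<bullet> qvec n b"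
  let ?e = "\<lambda>h t. brow n (res n h) (X h) (unit_vec (n - 1) t) $ k"
  define C where "C h l s = (\<Sum>t<n - 1. y_coeff n X h t l s * ?e h t)" for h l s
  let ?B = "\<lambda>h. beta n (res n h) (X h) (full_y n N Y X h) (full_y n N Z X h)"
  have B: "?B h $$ (j, k) = brow n (res n h) (X h) (?w h) $ k" for h
    using jk by (simp add: beta_index W_def)
  have dims: "dim_row (?B h) = 2" "dim_col (?B h) = n" for h
    using beta_carrier[of n "res n h" "X h" "full_y n N Y X h" "full_y n N Z X h"] by auto
  have brow: "brow n (res n h) (X h) (?w h) $ k =
      (\<Sum>l\<in>{n + 2..N}. \<Sum>s<n - 1. C h l s * W l $ s)"
    if h: "h \<in> {1..N}" for h
  proof -
    have "?w h \<in> carrier_vec (n - 1)"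
      using PiE_mem[OF full_y_system(1)[OF n D(3) Wc] h] .
    then have "brow n (res n h) (X h) (?w h) $ k = (\<Sum>t<n - 1. ?w h $ t * ?e h t)"
      using res_bounds[of n h] n jk by (intro brow_linear) auto
    also have "\<dots> = (\<Sum>t<n - 1. \<Sum>l\<in>{n + 2..N}. \<Sum>s<n - 1. y_coeff n X h t l s * ?e h t * W l $ s)"
      using full_y_eq[OF n D(3) Wc] h
      by (intro sum.cong refl) (simp add: sum_distrib_left sum_distrib_right mult_ac)
    also have "\<dots> = (\<Sum>l\<in>{n + 2..N}. \<Sum>t<n - 1. \<Sum>s<n - 1. y_coeff n X h t l s * ?e h t * W l $ s)"
      by (rule sum.swap)
    also have "\<dots> = (\<Sum>l\<in>{n + 2..N}. \<Sum>s<n - 1. \<Sum>t<n - 1. y_coeff n X h t l s * ?e h t * W l $ s)"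
      by (intro sum.cong refl sum.swap)
    finally show ?thesis by (simp only: sum_distrib_right C_def)
  qed
  have "snd (eta n N (P, X, Y, Z, b, \<kappa>) i) $$ (j, k) =
      (\<Sum>h\<in>{1..<i}. ?s h * ?B h $$ (j, k)) + \<kappa> i * (?s i * ?B i $$ (j, k))"
    using jk by (simp add: partial_comb_def matrix_sum_def dims)
  also have "\<dots> = (\<Sum>h\<in>{1..N}. weight \<kappa> i h * (?s h * ?B h $$ (j, k)))"
    by (rule sum_weight[OF i])
  also have "\<dots> = (\<Sum>h\<in>{1..N}. \<Sum>l\<in>{n + 2..N}. \<Sum>s<n - 1.
      weight \<kappa> i h * (?s h * C h l s) * W l $ s)"
    by (intro sum.cong refl) (simp only: B brow sum_distrib_left mult.assoc)
  also have "\<dots> = (\<Sum>l\<in>{n + 2..N}. \<Sum>h\<in>{1..N}. \<Sum>s<n - 1.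
      weight \<kappa> i h * (?s h * C h l s) * W l $ s)"
    by (rule sum.swap)
  also have "\<dots> = (\<Sum>l\<in>{n + 2..N}. \<Sum>s<n - 1. \<Sum>h\<in>{1..N}.
      weight \<kappa> i h * (?s h * C h l s) * W l $ s)"
    by (intro sum.cong refl sum.swap)
  finally show ?thesis
    by (simp only: y_eta_coeff_def C_def[symmetric] sum_distrib_right W_def)
qed

section \<open>Rationality of the coefficients\<close>

lemma polynomial_in_alpha:
  assumes "\<And>k. k < n - 1 \<Longrightarrow> polynomial_in G (\<lambda>v. x v $ k)" "k < n" "r \<le> n"
  shows "polynomial_in G (\<lambda>v. alpha n r (x v) $ k)"
proof -
  have "polynomial_in G (\<lambda>v. if k < r - 1 then x v $ k else if k = r - 1 then 1 else x v $ (k - 1))"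
    using assms(2,3) by (intro polynomial_in_if polynomial_in.const assms(1)) auto
  then show ?thesis using assms(2) by (simp add: alpha_def)
qed

text \<open>\<open>y\<close> is constant, in the applications a unit vector, so \<open>x\<close>
  enters only through the distinguished entry.\<close>

lemma polynomial_in_brow:
  assumes "\<And>k. k < n - 1 \<Longrightarrow> polynomial_in G (\<lambda>v. x v $ k)" "k < n" "dim_vec y = n - 1"
  shows "polynomial_in G (\<lambda>v. brow n r (x v) y $ k)"
proof -
  have "polynomial_in G (\<lambda>v. if k < r - 1 then y $ k else if k = r - 1 then - (x v \<bullet> y) else y $ (k - 1))"
    unfolding scalar_prod_def
    by (intro polynomial_in_if polynomial_in.const polynomial_in_uminus polynomial_in_sum
        polynomial_in.mult assms(1)) (simp add: assms(3))
  then show ?thesis using assms(2) by (simp add: brow_def)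
qed

lemma polynomial_in_weight:
  "polynomial_in G (\<lambda>v. \<kappa> v i) \<Longrightarrow> polynomial_in G (\<lambda>v. weight (\<kappa> v) i h)"
  unfolding weight_def by (intro polynomial_in_if polynomial_in.const)

lemma polynomial_in_T_entry:
  assumes "\<And>k. k < n - 1 \<Longrightarrow> polynomial_in G (\<lambda>v. X v i $ k)"
    and "n \<ge> 2" "e < n\<^sup>2 - 1" "dim_vec y = n - 1"
  shows "polynomial_in G (\<lambda>v. T_entry n (X v) i y e)"
  unfolding T_entry_def
  using assms res_bounds[of n i]
  by (intro polynomial_in.mult polynomial_in_brow polynomial_in_alpha T_index_bound) auto

context
  fixes n N :: nat and G :: "('a \<Rightarrow> real) set" and X :: "'a \<Rightarrow> nat \<Rightarrow> real vec"
  assumes n: "n \<ge> 2" "n + 1 \<le> N"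
    and X: "\<And>i k. i \<in> {1..N} \<Longrightarrow> k < n - 1 \<Longrightarrow> polynomial_in G (\<lambda>v. X v i $ k)"
begin

text \<open>Cramer's rule gives a quotient of polynomials in the entries of \<open>X\<close> with
  denominator \<open>Delta\<close>. The type of \<open>v\<close> stays abstract because the two
  matrices of \<open>eta\<close> use different parameter spaces.\<close>

lemma rational_on_p_coeff:
  assumes "\<And>v. v \<in> S \<Longrightarrow> Delta n (X v) \<noteq> 0" "i \<in> {1..N}" "l \<in> {1..N}"
  shows "rational_on G S (\<lambda>v. p_coeff n (X v) i l)"
proof (cases "i \<le> n")
  case True
  have entry: "polynomial_in G (\<lambda>v. alpha_mat n (X v) $$ (k, h))" if "k < n" "h < n" for k h
    using that n by (simp add: alpha_mat_index polynomial_in_alpha X)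
  have "polynomial_in G (\<lambda>v. Delta n (X v))"
    unfolding Delta_def alpha_mat_def[symmetric]
    by (rule polynomial_in_det[OF alpha_mat_carrier entry])
  moreover have "polynomial_in G (\<lambda>v. \<Sum>k<n.
      adj_mat (alpha_mat n (X v)) $$ (i - 1, k) * - alpha n (res n l) (X v l) $ k)"
    using True assms(2,3) n res_bounds[of n l]
    by (intro polynomial_in_sum polynomial_in.mult polynomial_in_uminus polynomial_in_alpha X
        polynomial_in_adj_mat[OF alpha_mat_carrier entry]) auto
  ultimately show ?thesis
    using True assms(1) by (auto simp: p_coeff_def intro!: rational_on_divide)
qed (auto simp: p_coeff_def intro!: rational_on_polynomial polynomial_in.const)

text \<open>Here the denominator is \<open>T_det\<close>; the entries of \<open>T_mat\<close> are
  polynomial as sums of \<open>T_entry\<close> at vectors independent of \<open>v\<close>.\<close>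

lemma rational_on_y_coeff:
  assumes "\<And>v. v \<in> S \<Longrightarrow> T_det n (X v) \<noteq> 0" "i \<in> {1..N}" "l \<in> {1..N}" "t < n - 1"
  shows "rational_on G S (\<lambda>v. y_coeff n (X v) i t l s)"
proof (cases "i \<le> n + 1")
  case True
  have entry: "polynomial_in G (\<lambda>v. T_mat n (X v) $$ (e, c))" if "e < n\<^sup>2 - 1" "c < n\<^sup>2 - 1" for e c
    unfolding T_mat_index[OF n(1) that]
    using that n by (intro polynomial_in_sum polynomial_in_T_entry X) auto
  have "polynomial_in G (\<lambda>v. T_det n (X v))"
    unfolding T_det_def T_mat_def[symmetric]
    by (rule polynomial_in_det[OF T_mat_carrier entry])
  moreover have "(i - 1) * (n - 1) + t < n\<^sup>2 - 1"
    using True assms(2,4) by (intro stack_index_bound) auto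
  then have "polynomial_in G (\<lambda>v. \<Sum>e<n\<^sup>2 - 1. adj_mat (T_mat n (X v)) $$ ((i - 1) * (n - 1) + t, e) *
      - T_entry n (X v) l (unit_vec (n - 1) s) e)"
    using assms(3) n
    by (intro polynomial_in_sum polynomial_in.mult polynomial_in_uminus polynomial_in_T_entry X
        polynomial_in_adj_mat[OF T_mat_carrier entry]) auto
  ultimately show ?thesis
    using True assms(1) by (simp add: y_coeff_def rational_on_divide)
qed (auto simp: y_coeff_def intro!: rational_on_polynomial polynomial_in.const)

lemma rational_on_p_eta_coeff:
  assumes "\<And>v. v \<in> S \<Longrightarrow> Delta n (X v) \<noteq> 0" "polynomial_in G (\<lambda>v. \<kappa> v i)" "k < n" "l \<in> {1..N}"
  shows "rational_on G S (\<lambda>v. p_eta_coeff n N (X v) (\<kappa> v) i k l)"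
  unfolding p_eta_coeff_def
  by (intro rational_on_sum rational_on_mult rational_on_p_coeff rational_on_polynomial
      polynomial_in_weight polynomial_in_alpha X)
     (use assms n res_bounds[of n] in auto)

lemma rational_on_y_eta_coeff:
  assumes "\<And>v. v \<in> S \<Longrightarrow> T_det n (X v) \<noteq> 0" "polynomial_in G (\<lambda>v. \<kappa> v i)" "k < n" "l \<in> {1..N}"
    and b: "\<And>k. k < n - 2 \<Longrightarrow> polynomial_in G (\<lambda>v. b v $ k)"
  shows "rational_on G S (\<lambda>v. y_eta_coeff n N (X v) (b v) (\<kappa> v) i k l s)"
proof -
  have "polynomial_in G (\<lambda>v. alpha n (res n h) (X v h) \<bullet> qvec n (b v))" if "h \<in> {1..N}" for h
  proof -
    have dim: "dim_vec (qvec n c) = n" for c by (simp add: qvec_def)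
    have q: "polynomial_in G (\<lambda>v. qvec n (b v) $ k)" if "k < n" for k
    proof -
      have "polynomial_in G (\<lambda>v. if k < 2 then 1 else b v $ (k - 2))"
        using that by (intro polynomial_in_if polynomial_in.const b) auto
      then show ?thesis using that by (simp add: qvec_def)
    qed
    show ?thesis
      unfolding scalar_prod_def dim
      by (intro polynomial_in_sum polynomial_in.mult polynomial_in_alpha X q)
         (use that n res_bounds[of n h] in auto)
  qed
  then show ?thesis
    unfolding y_eta_coeff_def
    by (intro rational_on_sum rational_on_mult rational_on_y_coeff rational_on_polynomial[of _ "\<lambda>v. _ \<bullet> _"]
        rational_on_polynomial polynomial_in_weight polynomial_in_brow X)
       (use assms in auto)
qed

end

section \<open>The configuration property together with the two linearity claims\<close>

theorem proposition4p1:
  fixes n N :: nat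
  assumes "n \<ge> 2" and "N \<ge> n + 3"
  shows "(\<forall>U\<in>U_set n N. tau_configuration 2 n N (eta n N U)) \<and>
    (\<forall>i\<in>{1..N}. \<forall>j<2. \<forall>k<n.
      (\<exists>c.
        (\<forall>l\<in>{n + 1..N}. \<forall>t<2.
          rational_on (coords_X_kappa n N) (proj_X_kappa ` U_set n N) (c l t)) \<and>
        (\<forall>(P, X, Y, Z, b, \<kappa>)\<in>U_set n N.
          fst (eta n N (P, X, Y, Z, b, \<kappa>) i) $$ (j, k) =
            (\<Sum>l\<in>{n + 1..N}. \<Sum>t<2. c l t (X, \<kappa>) * P l $ t))) \<and>
      (\<exists>c d.
        (\<forall>l\<in>{n + 2..N}. \<forall>t<n - 1.
          rational_on (coords_X_b_kappa n N) (proj_X_b_kappa ` U_set n N) (c l t) \<and>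
          rational_on (coords_X_b_kappa n N) (proj_X_b_kappa ` U_set n N) (d l t)) \<and>
        (\<forall>(P, X, Y, Z, b, \<kappa>)\<in>U_set n N.
          snd (eta n N (P, X, Y, Z, b, \<kappa>) i) $$ (j, k) =
            (\<Sum>l\<in>{n + 2..N}. \<Sum>t<n - 1. c l t (X, b, \<kappa>) * Y l $ t) +
            (\<Sum>l\<in>{n + 2..N}. \<Sum>t<n - 1. d l t (X, b, \<kappa>) * Z l $ t))))"
proof (intro conjI ballI allI impI)
  have n: "n \<ge> 2" "n + 1 \<le> N" using assms by auto
  show "tau_configuration 2 n N (eta n N U)" if "U \<in> U_set n N" for U
    using tau_configuration_eta[OF n that] .
  fix i j k :: nat
  assume i: "i \<in> {1..N}" and jk: "j < 2" "k < n"
  let ?G = "coords_X_kappa n N" and ?S = "proj_X_kappa ` U_set n N"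
  let ?G' = "coords_X_b_kappa n N" and ?S' = "proj_X_b_kappa ` U_set n N"
  \<comment> \<open>Rewriting pattern matching by projections lets these functions be recognized as
    coordinates.\<close>
  have X: "polynomial_in ?G (\<lambda>v. fst v h $ t)" "polynomial_in ?G' (\<lambda>v. fst v h $ t)"
    if "h \<in> {1..N}" "t < n - 1" for h t
    using that unfolding coords_X_kappa_def coords_X_b_kappa_def case_prod_beta
    by (auto intro!: polynomial_in.coord)
  have \<kappa>: "polynomial_in ?G (\<lambda>v. snd v i)" "polynomial_in ?G' (\<lambda>v. snd (snd v) i)"
    using i unfolding coords_X_kappa_def coords_X_b_kappa_def case_prod_beta
    by (auto intro!: polynomial_in.coord)
  have b: "polynomial_in ?G' (\<lambda>v. fst (snd v) $ t)" if "t < n - 2" for t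
    using that unfolding coords_X_b_kappa_def case_prod_beta
    by (auto intro!: polynomial_in.coord)
  \<comment> \<open>The two nonvanishing conditions exclude poles on the projections of
    \<open>U_set\<close>.\<close>
  have Delta: "Delta n (fst v) \<noteq> 0" if "v \<in> ?S" for v
    using that U_setD(2) by auto
  have T: "T_det n (fst v) \<noteq> 0" if "v \<in> ?S'" for v
    using that U_setD(3) by auto
  have zero: "rational_on H R (\<lambda>_. 0)" for H and R :: "'x set"
    by (intro rational_on_polynomial polynomial_in.const)
  show "\<exists>c. (\<forall>l\<in>{n + 1..N}. \<forall>t<2. rational_on ?G ?S (c l t)) \<and>
      (\<forall>(P, X, Y, Z, b, \<kappa>)\<in>U_set n N.
        fst (eta n N (P, X, Y, Z, b, \<kappa>) i) $$ (j, k) =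
          (\<Sum>l\<in>{n + 1..N}. \<Sum>t<2. c l t (X, \<kappa>) * P l $ t))"
  proof (intro exI conjI ballI allI impI)
    \<comment> \<open>Row \<open>j\<close> involves only component \<open>j\<close> of each
      \<open>p_l\<close>; the other component gets coefficient zero.\<close>
    let ?c = "\<lambda>l t v. if t = j then p_eta_coeff n N (fst v) (snd v) i k l else 0"
    show "rational_on ?G ?S (?c l t)" if "l \<in> {n + 1..N}" "t < 2" for l t
      using rational_on_p_eta_coeff[OF n, where X = fst and \<kappa> = snd and l = l, OF X(1) Delta \<kappa>(1) jk(2)] that zero
      by (cases "t = j") auto
    show "case U of (P, X, Y, Z, b, \<kappa>) \<Rightarrow>
        fst (eta n N (P, X, Y, Z, b, \<kappa>) i) $$ (j, k) =
          (\<Sum>l\<in>{n + 1..N}. \<Sum>t<2. ?c l t (X, \<kappa>) * P l $ t)" if U: "U \<in> U_set n N" for U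
    proof -
      obtain P X Y Z b \<kappa> where U_eq: "U = (P, X, Y, Z, b, \<kappa>)" by (cases U) auto
      have "(\<Sum>t<2. ?c l t (X, \<kappa>) * P l $ t) = p_eta_coeff n N X \<kappa> i k l * P l $ j" for l
      proof -
        have "(\<Sum>t<2. ?c l t (X, \<kappa>) * P l $ t) =
            (\<Sum>t<2. if t = j then p_eta_coeff n N X \<kappa> i k l * P l $ t else 0)"
          by (intro sum.cong) auto
        then show ?thesis using jk by simp
      qed
      then show ?thesis
        using eta_fst[OF n U[unfolded U_eq] i jk] unfolding U_eq prod.case by (simp only:)
    qed
  qed
  show "\<exists>c d. (\<forall>l\<in>{n + 2..N}. \<forall>t<n - 1. rational_on ?G' ?S' (c l t) \<and> rational_on ?G' ?S' (d l t)) \<and>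
      (\<forall>(P, X, Y, Z, b, \<kappa>)\<in>U_set n N.
        snd (eta n N (P, X, Y, Z, b, \<kappa>) i) $$ (j, k) =
          (\<Sum>l\<in>{n + 2..N}. \<Sum>t<n - 1. c l t (X, b, \<kappa>) * Y l $ t) +
          (\<Sum>l\<in>{n + 2..N}. \<Sum>t<n - 1. d l t (X, b, \<kappa>) * Z l $ t))"
  proof (intro exI conjI ballI allI impI)
    let ?y = "\<lambda>l t v. y_eta_coeff n N (fst v) (fst (snd v)) (snd (snd v)) i k l t"
    \<comment> \<open>Row 0 involves only \<open>Y\<close> and row 1 only \<open>Z\<close>, so one
      of the two coefficient families is zero.\<close>
    let ?c = "\<lambda>l t v. if j = 0 then ?y l t v else 0"
    let ?d = "\<lambda>l t v. if j = 0 then 0 else ?y l t v"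
    have y: "rational_on ?G' ?S' (?y l t)" if "l \<in> {n + 2..N}" for l t
      using that by (intro rational_on_y_eta_coeff[OF n, where X = fst and \<kappa> = "\<lambda>v. snd (snd v)"
            and b = "\<lambda>v. fst (snd v)", OF X(2) T \<kappa>(2) jk(2) _ b]) auto
    show "rational_on ?G' ?S' (?c l t)" "rational_on ?G' ?S' (?d l t)"
      if "l \<in> {n + 2..N}" "t < n - 1" for l t
      by (cases "j = 0"; simp only: if_True if_False zero y[OF that(1)])+
    show "case U of (P, X, Y, Z, b, \<kappa>) \<Rightarrow>
        snd (eta n N (P, X, Y, Z, b, \<kappa>) i) $$ (j, k) =
          (\<Sum>l\<in>{n + 2..N}. \<Sum>t<n - 1. ?c l t (X, b, \<kappa>) * Y l $ t) +
          (\<Sum>l\<in>{n + 2..N}. \<Sum>t<n - 1. ?d l t (X, b, \<kappa>) * Z l $ t)" if U: "U \<in> U_set n N" for U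
    proof -
      obtain P X Y Z b \<kappa> where U_eq: "U = (P, X, Y, Z, b, \<kappa>)" by (cases U) auto
      show ?thesis
        using eta_snd[OF n U[unfolded U_eq] i jk] unfolding U_eq prod.case
        by (cases "j = 0") (simp_all only: simp_thms if_True if_False fst_conv snd_conv mult_zero_left
            sum.neutral_const add_0_left add_0_right)
    qed
  qed
qed

end
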